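(* Let $o$ be a $\lambda\mu$-object. Then $o$ is typable in system $\mathcal{S}_{\lambda\mu}$ if and only if $o$ is strongly normalizing for $\lambda\mu$-reduction. Moreover, if $\Pi$ is an $\mathcal{S}_{\lambda\mu}$ derivation typing $o$, then $\mathrm{sz}(\Pi)$ is an upper bound on the maximal length of a reduction sequence starting at $o$.
   Context: The $\lambda\mu$-calculus. Fix countably infinite sets of variables $x,y,\dots$ and names $\alpha,\beta,\gamma,\dots$. Terms $t,u ::= x \mid \lambda x.t \mid t\,u \mid \mu\alpha.c$; commands $c ::= [\alpha]t$; objects $o ::= t \mid c$. $\lambda x$ binds $x$, $\mu\alpha$ binds $\alpha$; $\mathrm{fv}(o)$, $\mathrm{fn}(o)$ are free variables and free names ($\mathrm{fn}([\alpha]t)=\mathrm{fn}(t)\cup\{\alpha\}$); objects are identified up to renaming of bound variables and names. $o\{x/u\}$ is capture-avoiding substitution. The replacement $o\{\alpha/\!\!/u\}$ is defined by $x\{\alpha/\!\!/u\}=x$, homomorphically on abstraction, application and $\mu\gamma$, $([\gamma]t)\{\alpha/\!\!/u\}=[\gamma](t\{\alpha/\!\!/u\})$ for $\gamma\neq\alpha$, $([\alpha]t)\{\alpha/\!\!/u\}=[\alpha]((t\{\alpha/\!\!/u\})\,u)$. Reduction $\to$ is the closure under all contexts of $(\lambda x.t)u\to t\{x/u\}$ and $(\mu\alpha.c)u\to\mu\alpha.(c\{\alpha/\!\!/u\})$. An object is strongly normalizing if there is no infinite reduction sequence from it. Types: base types $a$; types $\sigma ::= a \mid \mathcal{I}\Rightarrow\mathcal{U}$;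 union types $\mathcal{U}=\langle\sigma_k\rangle_{k\in K}$ (finite multisets of types); intersection types $\mathcal{I}=[\mathcal{U}_k]_{k\in K}$ (finite multisets of union types); object types are union types or the constant $\#$. Blind types $\xi ::= a \mid [\,]\Rightarrow\langle\xi\rangle$. $\wedge$, $\vee$ are multiset union. Choice: $\mathcal{I}^{*}=\mathcal{I}$ if $\mathcal{I}\neq[\,]$, and $[\,]^{*}$ is $[\mathcal{U}]$ for an arbitrary non-empty union type $\mathcal{U}$; $\mathcal{U}^{*}=\mathcal{U}$ if $\mathcal{U}\neq\langle\,\rangle$, and $\langle\,\rangle^{*}$ is $\langle\xi\rangle$ for an arbitrary blind type $\xi$. Arity: $\mathrm{ar}(a)=0$, $\mathrm{ar}(\mathcal{I}\Rightarrow\mathcal{U})=\mathrm{ar}(\mathcal{U})+1$, $\mathrm{ar}(\langle\sigma_k\rangle_k)=\sum_k\mathrm{ar}(\sigma_k)$. Variable assignments $\Gamma$ (variables to intersection types) and name assignments $\Delta$ (names to union types) have as domain the elements with non-empty image; $\wedge$, $\vee$ act pointwise; $;$ denotes this for disjoint domains; $\Gamma\setminus x$, $\Delta\setminus\alpha$ empty the given entry. System $\mathcal{S}_{\lambda\mu}$ (regular judgments $\Gamma\vdash o:\mathcal{A}\mid\Delta$, auxiliary $\Gamma\Vdash t:\mathcal{I}\mid\Delta$): (ax) $x:[\mathcal{U}]\vdash x:\mathcal{U}\mid\emptyset$ if $\mathcal{U}\neq\langle\,\rangle$; ($\Rightarrow_i$) from $\Gamma\vdash t:\mathcal{U}\mid\Delta$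 infer $\Gamma\setminus x\vdash\lambda x.t:\langle\Gamma(x)\Rightarrow\mathcal{U}\rangle\mid\Delta$; ($\#_i$) from $\Gamma\vdash t:\mathcal{U}\mid\Delta$ infer $\Gamma\vdash[\alpha]t:\#\mid\Delta\vee\{\alpha:\mathcal{U}\}$; ($\#_e$) from $\Gamma\vdash c:\#\mid\Delta$ infer $\Gamma\vdash\mu\alpha.c:(\Delta(\alpha))^{*}\mid\Delta\setminus\alpha$; ($\wedge$) from $(\Gamma_k\vdash t:\mathcal{U}_k\mid\Delta_k)_{k\in K}$ infer $\wedge_k\Gamma_k\Vdash t:[\mathcal{U}_k]_{k\in K}\mid\vee_k\Delta_k$; ($\Rightarrow_{e*}$) from $\Gamma_t\vdash t:\langle\mathcal{I}_k\Rightarrow\mathcal{U}_k\rangle_{k\in K}\mid\Delta_t$ and $\Gamma_u\Vdash u:\wedge_k(\mathcal{I}_k)^{*}\mid\Delta_u$ infer $\Gamma_t\wedge\Gamma_u\vdash t\,u:\vee_k\mathcal{U}_k\mid\Delta_t\vee\Delta_u$. Typable means some regular judgment about the object is derivable. Size: (ax) is 1; ($\Rightarrow_i$), ($\#_e$) add 1; ($\#_i$) adds $\mathrm{ar}(\mathcal{U})$; ($\wedge$) sums the premises; ($\Rightarrow_{e*}$) sums the premises and adds $|K|$.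
   Formalization: In rule (⇒e* ) every codomain U_k of an eliminated arrow is required to be non-empty; without this, x:[⟨[ ]⇒⟨⟩⟩] and y:V give x y:⟨⟩, and then (x y)u is typable with K empty for every u, even a non-normalizing one. *)

theory Defs
  imports Main "HOL-Library.Multiset"
begin

section \<open>The \<open>\<lambda>\<mu>\<close>-calculus\<close>

text \<open>
  Objects up to renaming of bound variables and names are represented with de Bruijn indices, with
  two independent index spaces: \<open>Lam\<close> binds variable 0 of its body and \<open>Mu\<close> binds name 0 of its
  body. Indices pointing beyond all enclosing binders are free.
\<close>

datatype trm = Var nat | Lam trm | App trm trm | Mu cmd
  and cmd = Named nat trm

datatype obj = Term trm | Cmd cmd

text \<open>Renaming that makes room for a new variable (respectively name) with index \<open>k\<close>.\<close>

primrec shift_var_t :: "nat \<Rightarrow> trm \<Rightarrow> trm" and shift_var_c :: "nat \<Rightarrow> cmd \<Rightarrow> cmd" where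
  "shift_var_t k (Var i) = Var (if i < k then i else Suc i)"
| "shift_var_t k (Lam t) = Lam (shift_var_t (Suc k) t)"
| "shift_var_t k (App t u) = App (shift_var_t k t) (shift_var_t k u)"
| "shift_var_t k (Mu c) = Mu (shift_var_c k c)"
| "shift_var_c k (Named \<gamma> t) = Named \<gamma> (shift_var_t k t)"

primrec shift_name_t :: "nat \<Rightarrow> trm \<Rightarrow> trm" and shift_name_c :: "nat \<Rightarrow> cmd \<Rightarrow> cmd" where
  "shift_name_t k (Var i) = Var i"
| "shift_name_t k (Lam t) = Lam (shift_name_t k t)"
| "shift_name_t k (App t u) = App (shift_name_t k t) (shift_name_t k u)"
| "shift_name_t k (Mu c) = Mu (shift_name_c (Suc k) c)"
| "shift_name_c k (Named \<gamma> t) = Named (if \<gamma> < k then \<gamma> else Suc \<gamma>) (shift_name_t k t)"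

text \<open>
  \<open>subst_t x u t\<close> is \<open>t{x/u}\<close>; since it is used when the binder of \<open>x\<close> disappears, the variables
  above \<open>x\<close> are decremented.
\<close>

primrec subst_t :: "nat \<Rightarrow> trm \<Rightarrow> trm \<Rightarrow> trm" and subst_c :: "nat \<Rightarrow> trm \<Rightarrow> cmd \<Rightarrow> cmd" where
  "subst_t x u (Var i) = (if i < x then Var i else if i = x then u else Var (i - 1))"
| "subst_t x u (Lam t) = Lam (subst_t (Suc x) (shift_var_t 0 u) t)"
| "subst_t x u (App t v) = App (subst_t x u t) (subst_t x u v)"
| "subst_t x u (Mu c) = Mu (subst_c x (shift_name_t 0 u) c)"
| "subst_c x u (Named \<gamma> t) = Named \<gamma> (subst_t x u t)"

text \<open>
  \<open>repl_t \<alpha> u t\<close> is \<open>t{\<alpha>//u}\<close>. The name \<open>\<alpha>\<close> is still present afterwards, so no index is decremented.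
\<close>

primrec repl_t :: "nat \<Rightarrow> trm \<Rightarrow> trm \<Rightarrow> trm" and repl_c :: "nat \<Rightarrow> trm \<Rightarrow> cmd \<Rightarrow> cmd" where
  "repl_t \<alpha> u (Var i) = Var i"
| "repl_t \<alpha> u (Lam t) = Lam (repl_t \<alpha> (shift_var_t 0 u) t)"
| "repl_t \<alpha> u (App t v) = App (repl_t \<alpha> u t) (repl_t \<alpha> u v)"
| "repl_t \<alpha> u (Mu c) = Mu (repl_c (Suc \<alpha>) (shift_name_t 0 u) c)"
| "repl_c \<alpha> u (Named \<gamma> t) =
     (if \<gamma> = \<alpha> then Named \<alpha> (App (repl_t \<alpha> u t) u) else Named \<gamma> (repl_t \<alpha> u t))"

inductive red :: "obj \<Rightarrow> obj \<Rightarrow> bool" where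
  beta: "red (Term (App (Lam t) u)) (Term (subst_t 0 u t))"
| mu: "red (Term (App (Mu c) u)) (Term (Mu (repl_c 0 (shift_name_t 0 u) c)))"
| Lam: "red (Term t) (Term t') \<Longrightarrow> red (Term (Lam t)) (Term (Lam t'))"
| AppL: "red (Term t) (Term t') \<Longrightarrow> red (Term (App t u)) (Term (App t' u))"
| AppR: "red (Term u) (Term u') \<Longrightarrow> red (Term (App t u)) (Term (App t u'))"
| Mu: "red (Cmd c) (Cmd c') \<Longrightarrow> red (Term (Mu c)) (Term (Mu c'))"
| Named: "red (Term t) (Term t') \<Longrightarrow> red (Cmd (Named \<alpha> t)) (Cmd (Named \<alpha> t'))"

definition strongly_normalizing :: "obj \<Rightarrow> bool" where
  "strongly_normalizing ob \<longleftrightarrow> \<not> (\<exists>f :: nat \<Rightarrow> obj. f 0 = ob \<and> (\<forall>i. red (f i) (f (Suc i))))"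


section \<open>Types\<close>

text \<open>The base types are the elements of an arbitrary type \<open>'b\<close>.\<close>

datatype 'b ty = Base 'b | Arr "'b ty multiset multiset" "'b ty multiset"

type_synonym 'b uty = "'b ty multiset"
type_synonym 'b ity = "'b uty multiset"

datatype 'b objty = UTy "'b uty" | Hash

inductive blind :: "'b ty \<Rightarrow> bool" where
  "blind (Base a)"
| "blind \<xi> \<Longrightarrow> blind (Arr {#} {#\<xi>#})"

text \<open>The choice operators are non-deterministic: \<open>ichoice I J\<close> says that \<open>J\<close> is a possible \<open>I\<^sup>*\<close>.\<close>

definition ichoice :: "'b ity \<Rightarrow> 'b ity \<Rightarrow> bool" where
  "ichoice I J \<longleftrightarrow> (if I = {#} then \<exists>U. U \<noteq> {#} \<and> J = {#U#} else J = I)"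

definition uchoice :: "'b uty \<Rightarrow> 'b uty \<Rightarrow> bool" where
  "uchoice U V \<longleftrightarrow> (if U = {#} then \<exists>\<xi>. blind \<xi> \<and> V = {#\<xi>#} else V = U)"

primrec ar :: "'b ty \<Rightarrow> nat" where
  "ar (Base a) = 0"
| "ar (Arr I U) = sum_mset (image_mset ar U) + 1"

definition ar_u :: "'b uty \<Rightarrow> nat" where
  "ar_u U = sum_mset (image_mset ar U)"


section \<open>The typing system\<close>

text \<open>
  Derivation trees, for regular and auxiliary judgments. Nodes carry the applied rule and the data
  on which the size depends: the type of the premise of \<open>HashI\<close> and the cardinality of the index
  set of \<open>ArrE\<close>. Both are tied to the judgments by the relation \<open>derives\<close> below.
\<close>

datatype 'b deriv =
    Ax
  | ArrI "'b deriv"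
  | HashI "'b uty" "'b deriv"
  | HashE "'b deriv"
  | ArrE nat "'b deriv" "'b aux_deriv"
and 'b aux_deriv = Conj "'b deriv list"

primrec sz :: "'b deriv \<Rightarrow> nat" and sz_aux :: "'b aux_deriv \<Rightarrow> nat" where
  "sz Ax = 1"
| "sz (ArrI \<Pi>) = sz \<Pi> + 1"
| "sz (HashI U \<Pi>) = sz \<Pi> + ar_u U"
| "sz (HashE \<Pi>) = sz \<Pi> + 1"
| "sz (ArrE n \<Pi> \<Theta>) = sz \<Pi> + sz_aux \<Theta> + n"
| "sz_aux (Conj \<Pi>s) = sum_list (map sz \<Pi>s)"

text \<open>
  \<open>derives \<Pi> \<Gamma> ob A \<Delta>\<close>: the tree \<open>\<Pi>\<close> is a derivation of \<open>\<Gamma> \<turnstile> ob : A | \<Delta>\<close>;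
  \<open>derives_aux \<Theta> \<Gamma> t I \<Delta>\<close>: the tree \<open>\<Theta>\<close> is a derivation of the auxiliary \<open>\<Gamma> \<tturnstile> t : I | \<Delta>\<close>.
  Assignments are total functions, an entry outside the domain being \<open>{#}\<close>. Emptying the entry of
  a bound variable or name amounts to dropping entry 0 and decrementing the other indices.
  A finite index set \<open>K\<close> is \<open>{..<n}\<close>.

  In \<open>arrE\<close>, the arrows that are eliminated must have a non-empty codomain. This expresses, together
  with the side condition of \<open>ax\<close> and the choice in \<open>hashE\<close>, the convention that a term is never
  assigned the empty union type. Without it \<open>x y\<close> has type \<open>{#}\<close> for \<open>x : {#{#Arr {#} {#}#}#}\<close>, and
  then \<open>x y u\<close> is typable (with an empty index set) for every term \<open>u\<close> whatsoever.
\<close>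

inductive derives ::
    "'b deriv \<Rightarrow> (nat \<Rightarrow> 'b ity) \<Rightarrow> obj \<Rightarrow> 'b objty \<Rightarrow> (nat \<Rightarrow> 'b uty) \<Rightarrow> bool"
  and derives_aux ::
    "'b aux_deriv \<Rightarrow> (nat \<Rightarrow> 'b ity) \<Rightarrow> trm \<Rightarrow> 'b ity \<Rightarrow> (nat \<Rightarrow> 'b uty) \<Rightarrow> bool"
where
  ax: "U \<noteq> {#} \<Longrightarrow>
    derives Ax ((\<lambda>_. {#})(x := {#U#})) (Term (Var x)) (UTy U) (\<lambda>_. {#})"
| arrI: "derives \<Pi> \<Gamma> (Term t) (UTy U) \<Delta> \<Longrightarrow>
    derives (ArrI \<Pi>) (\<lambda>i. \<Gamma> (Suc i)) (Term (Lam t)) (UTy {#Arr (\<Gamma> 0) U#}) \<Delta>"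
| hashI: "derives \<Pi> \<Gamma> (Term t) (UTy U) \<Delta> \<Longrightarrow>
    derives (HashI U \<Pi>) \<Gamma> (Cmd (Named \<alpha> t)) Hash (\<Delta>(\<alpha> := \<Delta> \<alpha> + U))"
| hashE: "derives \<Pi> \<Gamma> (Cmd c) Hash \<Delta> \<Longrightarrow> uchoice (\<Delta> 0) V \<Longrightarrow>
    derives (HashE \<Pi>) \<Gamma> (Term (Mu c)) (UTy V) (\<lambda>i. \<Delta> (Suc i))"
| conj: "(\<And>k. k < n \<Longrightarrow> derives (\<Pi> k) (\<Gamma> k) (Term t) (UTy (U k)) (\<Delta> k)) \<Longrightarrow>
    derives_aux (Conj (map \<Pi> [0..<n])) (\<lambda>i. \<Sum>k<n. \<Gamma> k i) t
      (image_mset U (mset_set {..<n})) (\<lambda>i. \<Sum>k<n. \<Delta> k i)"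
| arrE: "derives \<Pi> \<Gamma>t (Term t) (UTy (image_mset (\<lambda>k. Arr (I k) (U k)) (mset_set {..<n}))) \<Delta>t \<Longrightarrow>
    (\<And>k. k < n \<Longrightarrow> U k \<noteq> {#}) \<Longrightarrow>
    (\<And>k. k < n \<Longrightarrow> ichoice (I k) (J k)) \<Longrightarrow>
    derives_aux \<Theta> \<Gamma>u u (\<Sum>k<n. J k) \<Delta>u \<Longrightarrow>
    derives (ArrE n \<Pi> \<Theta>) (\<lambda>i. \<Gamma>t i + \<Gamma>u i) (Term (App t u)) (UTy (\<Sum>k<n. U k))
      (\<lambda>i. \<Delta>t i + \<Delta>u i)"

text \<open>The first argument of \<open>typable\<close> fixes the type of base types.\<close>

definition typable :: "'b itself \<Rightarrow> obj \<Rightarrow> bool" where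
  "typable B ob \<longleftrightarrow> (\<exists>(\<Pi> :: 'b deriv) \<Gamma> A \<Delta>. derives \<Pi> \<Gamma> ob A \<Delta>)"

end

(*
  Typable implies strongly normalizing. Exact subject reduction fails: an erasing step shrinks the
  assignments, hence changes the types of enclosing abstractions. We pass to a system with
  weakening at the variables, where a bound variable or name may receive more types than it uses.
  There every step preserves the judgment and strictly decreases the weight: a beta step removes
  an abstraction and an application, while in a mu step every arrow that moves from a naming rule
  (arity) to a new application is counted once on either side, and the outer application vanishes.
  Derivations of the original system embed with weight equal to their size.

  Strongly normalizing implies typable. Induction on the reduction relation joined with the subterm
  relation. A term is an abstraction, a mu-abstraction, neutral, or has a head redex; in the last
  case the type of the reduct is expanded. Anti-substitution and anti-replacement lemmas recover
  the types of the argument from those of the reduct; if none is found, the step was erasing, and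
  the typing of the erased subterm given by the induction hypothesis fills the choice operator.
*)
theory Submission
  imports Defs "HOL-Library.Function_Algebras" "HOL-Library.Product_Plus"
begin

section \<open>Multisets of derivations\<close>

text \<open>An auxiliary judgment is a multiset of regular ones whose resources (weight and assignments,
  an element of a commutative monoid) are summed. The same predicate also pairs a union of arrows
  with the sum of the intersections it requires and of the unions it returns.\<close>

inductive gather :: "('r::comm_monoid_add \<Rightarrow> 'u \<Rightarrow> bool) \<Rightarrow> 'r \<Rightarrow> 'u multiset \<Rightarrow> bool"
  for P where
  empty: "gather P 0 {#}"
| add: "P r U \<Longrightarrow> gather P s J \<Longrightarrow> gather P (r + s) (add_mset U J)"

lemma gather_empty_iff [simp]: "gather P r {#} \<longleftrightarrow> r = 0"
  by (auto elim: gather.cases intro: gather.empty)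

lemma gather_single: "P r U \<Longrightarrow> gather P r {#U#}"
  using gather.add[of P r U 0 "{#}"] by simp

lemma gather_union: "gather P r I \<Longrightarrow> gather P s J \<Longrightarrow> gather P (r + s) (I + J)"
  by (induction rule: gather.induct) (auto simp: add.assoc intro: gather.add)

lemma gather_add_msetD:
  assumes "gather P r (add_mset U J)"
  shows "\<exists>r1 r2. r = r1 + r2 \<and> P r1 U \<and> gather P r2 J"
  using assms
proof (induction r "add_mset U J" arbitrary: J rule: gather.induct)
  case (add r V s K)
  show ?case
  proof (cases "U = V")
    case True
    then show ?thesis using add by auto
  next
    case False
    then obtain L where L: "K = add_mset U L" "J = add_mset V L"
      using add.hyps(4) by (auto simp: add_eq_conv_ex)
    then obtain r1 r2 where r12: "s = r1 + r2" "P r1 U" "gather P r2 L"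
      using add.hyps(3) by blast
    then have "r + s = r1 + (r + r2)" "gather P (r + r2) J"
      using gather.add[OF add.hyps(1) r12(3)] L by (simp_all add: ac_simps)
    then show ?thesis using r12 by blast
  qed
qed auto

lemma gather_unionD:
  assumes "gather P r (I + J)"
  shows "\<exists>r1 r2. r = r1 + r2 \<and> gather P r1 I \<and> gather P r2 J"
  using assms
proof (induction I arbitrary: r)
  case empty
  then show ?case by (intro exI[of _ 0] exI[of _ r]) auto
next
  case (add U I)
  then obtain r1 r2 where 1: "r = r1 + r2" "P r1 U" "gather P r2 (I + J)"
    using gather_add_msetD[of P r U "I + J"] by auto
  then obtain s1 s2 where 2: "r2 = s1 + s2" "gather P s1 I" "gather P s2 J"
    using add.IH by blast
  then have "r = (r1 + s1) + s2" "gather P (r1 + s1) (add_mset U I)"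
    using 1 by (auto simp: ac_simps intro: gather.add)
  then show ?case using 2 by blast
qed

text \<open>Summands are related one by one, and additivity of \<open>R\<close> combines the
  results. A relation rather than a function lets the same induction give images, preimages and
  weight inequalities.\<close>

lemma gather_rel:
  assumes "gather P r J" "R 0 0"
    and R_add: "\<And>r r' s s'. R r r' \<Longrightarrow> R s s' \<Longrightarrow> R (r + s) (r' + s')"
    and "\<And>r U. P r U \<Longrightarrow> \<exists>r'. R r r' \<and> Q r' U"
  shows "\<exists>r'. R r r' \<and> gather Q r' J"
  using assms(1)
proof induction
  case (add r U s J)
  then show ?case using assms(4)[OF add.hyps(1)] R_add gather.add by metis
qed (use assms(2) in auto)

lemma gather_map:
  assumes "gather P r J" "f 0 = 0" "\<And>r s. f (r + s) = f r + f s" "\<And>r U. P r U \<Longrightarrow> Q (f r) U"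
  shows "gather Q (f r) J"
  using gather_rel[of P r J "\<lambda>r r'. r' = f r" Q] assms by auto

text \<open>With \<open>gather_sumE\<close>, this translates to and from families indexed by
  \<open>{..<n}\<close>, the form in which the rules \<open>conj\<close> and \<open>arrE\<close> are
  stated.\<close>

lemma gather_sum:
  fixes r :: "nat \<Rightarrow> 'r::comm_monoid_add"
  shows "(\<And>k. k < n \<Longrightarrow> P (r k) (U k)) \<Longrightarrow>
    gather P (\<Sum>k<n. r k) (image_mset U (mset_set {..<n}))"
proof (induction n)
  case (Suc n)
  then show ?case by (auto simp: lessThan_Suc intro: gather.add)
qed simp

lemma gather_sumE:
  assumes "gather P s J"
  obtains r n U where "s = (\<Sum>k<n. r k)" "J = image_mset U (mset_set {..<n::nat})"
    "\<forall>k<n. P (r k) (U k)"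
proof -
  from assms have "\<exists>n r U. s = (\<Sum>k<n. r k) \<and> J = image_mset U (mset_set {..<n::nat}) \<and>
      (\<forall>k<n. P (r k) (U k))"
  proof induction
    case empty
    show ?case by (intro exI[of _ 0]) auto
  next
    case (add r0 U0 s J)
    then obtain n r U where *: "s = (\<Sum>k<n. r k)" "J = image_mset U (mset_set {..<n::nat})"
      "\<forall>k<n. P (r k) (U k)" by blast
    \<comment> \<open>The new member takes the fresh index \<open>n\<close>, so the values below
      \<open>n\<close> are untouched.\<close>
    have "(\<Sum>k<n. (r(n := r0)) k) = (\<Sum>k<n. r k)" by (rule sum.cong) auto
    moreover have "image_mset (U(n := U0)) (mset_set {..<n}) = image_mset U (mset_set {..<n})"
      by (rule image_mset_cong) auto
    ultimately show ?case using * add(1)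
      by (intro exI[of _ "Suc n"] exI[of _ "r(n := r0)"] exI[of _ "U(n := U0)"])
        (auto simp: lessThan_Suc less_Suc_eq simp del: fun_upd_apply, simp_all)
  qed
  then show ?thesis using that by blast
qed

lemma gather_single_iff [simp]: "gather P r {#U#} \<longleftrightarrow> P r U"
  using gather_add_msetD[of P r U "{#}"] gather_single[of P r U] by auto

text \<open>Pattern of substitution into the argument of an application: \<open>g\<close> reads off
  what a derivation demands, \<open>f\<close> drops that entry. Since \<open>g\<close> is additive,
  the supply \<open>s\<close> splits into shares, one for each derivation.\<close>

lemma gather_absorb:
  assumes "gather P r J" "gather Q s (g r)"
    and g: "g 0 = {#}" "\<And>r s. g (r + s) = g r + g s"
    and f: "f 0 = 0" "\<And>r s. f (r + s) = f r + f s"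
    and step: "\<And>r s U. P r U \<Longrightarrow> gather Q s (g r) \<Longrightarrow> P' (f r + s) U"
  shows "gather P' (f r + s) J"
  using assms(1,2)
proof (induction arbitrary: s)
  case empty
  then show ?case using f g by simp
next
  case (add r U r2 J)
  then obtain s1 s2 where s: "s = s1 + s2" "gather Q s1 (g r)" "gather Q s2 (g r2)"
    using gather_unionD[of Q s "g r" "g r2"] g by auto
  then have "gather P' ((f r + s1) + (f r2 + s2)) (add_mset U J)"
    using add step by (intro gather.add) auto
  then show ?case using s f by (simp add: ac_simps)
qed

text \<open>Converse of \<open>gather_absorb\<close>, for expansion: the supplies found in the
  individual derivations add up to one supply for the total demand.\<close>

lemma gather_extract:
  assumes "gather P' r' J"
    and g: "g 0 = {#}" "\<And>r s. g (r + s) = g r + g s"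
    and f: "f 0 = 0" "\<And>r s. f (r + s) = f r + f s"
    and step: "\<And>r' U. P' r' U \<Longrightarrow> \<exists>r s. r' = f r + s \<and> gather Q s (g r) \<and> P r U"
  shows "\<exists>r s. r' = f r + s \<and> gather Q s (g r) \<and> gather P r J"
proof -
  \<comment> \<open>Hiding the supply \<open>s\<close> inside the relation makes it additive, as
    \<open>gather_rel\<close> requires.\<close>
  let ?R = "\<lambda>r' r. \<exists>s. r' = f r + s \<and> gather Q s (g r)"
  have "\<exists>r. ?R r' r \<and> gather P r J"
  proof (rule gather_rel[OF assms(1), of ?R])
    fix r1 r2 s1 s2 assume "?R r1 r2" "?R s1 s2"
    then obtain a b where "r1 = f r2 + a" "gather Q a (g r2)" "s1 = f s2 + b" "gather Q b (g s2)"
      by blast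
    then show "?R (r1 + s1) (r2 + s2)"
      using f g by (intro exI[of _ "a + b"]) (auto simp: ac_simps intro: gather_union)
  qed (use f g step in \<open>auto\<close>, use step in blast)
  then show ?thesis by blast
qed


section \<open>Assignments and eliminated arrows\<close>

lemmas pointwise = fun_eq_iff plus_fun_apply zero_fun_apply

declare plus_fun_apply [simp del] zero_fun_apply [simp del]

text \<open>\<open>ins 0 a f\<close> is the assignment under a binder whose index 0 receives
  \<open>a\<close>; \<open>ins k 0 f\<close> mirrors the shifts.\<close>

definition ins :: "nat \<Rightarrow> 'a \<Rightarrow> (nat \<Rightarrow> 'a) \<Rightarrow> nat \<Rightarrow> 'a" where
  "ins k a f = (\<lambda>i. if i < k then f i else if i = k then a else f (i - 1))"

text \<open>Mirrors \<open>subst_t\<close>, which removes the index and decrements those above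
  it.\<close>

definition del :: "nat \<Rightarrow> (nat \<Rightarrow> 'a) \<Rightarrow> nat \<Rightarrow> 'a" where
  "del k f = (\<lambda>i. if i < k then f i else f (Suc i))"

definition sing :: "nat \<Rightarrow> 'a \<Rightarrow> nat \<Rightarrow> 'a::zero" where
  "sing k a = (\<lambda>i. if i = k then a else 0)"

text \<open>No index moves, because a replaced name survives the replacement.\<close>

definition erase :: "nat \<Rightarrow> (nat \<Rightarrow> 'a) \<Rightarrow> nat \<Rightarrow> 'a::zero" where
  "erase k f = f(k := 0)"

section \<open>Algebra of inserting, deleting and erasing entries\<close>

lemma ins_0_simps [simp]: "ins 0 a f 0 = a" "ins 0 a f (Suc i) = f i"
  by (auto simp: ins_def)

lemma ins_0_eq_iff [simp]: "ins 0 a f = ins 0 b g \<longleftrightarrow> a = b \<and> f = g"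
  by (metis ins_0_simps ext)

lemma ins_0_eta: "ins 0 (f 0) (\<lambda>i. f (Suc i)) = f"
  by (auto simp: ins_def pointwise)

lemma ins_Suc_ins_0: "ins (Suc k) a (ins 0 b f) = ins 0 b (ins k a f)"
  by (auto simp: ins_def pointwise)

lemma ins_zero [simp]: "ins k 0 0 = 0"
  by (auto simp: ins_def pointwise)

lemma ins_add: "ins k (a + b) (f + g) = ins k a f + ins k b g"
  by (auto simp: ins_def pointwise)

lemma ins_zero_add: "ins k 0 (f + g) = ins k 0 f + (ins k 0 g :: nat \<Rightarrow> 'a::monoid_add)"
  using ins_add[of k 0 0 f g] by simp

lemma ins_sing: "ins k 0 (sing i a) = sing (if i < k then i else Suc i) a"
  by (auto simp: ins_def sing_def pointwise)

lemma del_zero [simp]: "del k 0 = 0"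
  by (auto simp: del_def pointwise)

lemma del_add: "del k (f + g) = del k f + del k g"
  by (auto simp: del_def pointwise)

lemma del_Suc_ins_0: "del (Suc k) (ins 0 a f) = ins 0 a (del k f)"
  by (auto simp: del_def ins_def pointwise)

lemma del_0_ins_0 [simp]: "del 0 (ins 0 a f) = f"
  by (auto simp: del_def ins_def pointwise)

lemma del_sing_same: "del k (sing k a) = 0"
  by (auto simp: del_def sing_def pointwise)

lemma del_sing: "i \<noteq> k \<Longrightarrow> del k (sing i a) = sing (if i < k then i else i - 1) a"
  by (auto simp: del_def sing_def pointwise)

lemma erase_ins_0 [simp]:
  "erase 0 (ins 0 a f) = ins 0 0 f" "erase (Suc k) (ins 0 a f) = ins 0 a (erase k f)"
  by (auto simp: erase_def ins_def pointwise)

lemma erase_zero [simp]: "erase k 0 = 0"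
  by (auto simp: erase_def pointwise)

lemma erase_add: "erase k (f + g) = erase k f + (erase k g :: nat \<Rightarrow> 'a::monoid_add)"
  by (auto simp: erase_def pointwise)

lemma erase_sing: "erase k (sing i a) = (if i = k then 0 else sing i a)"
  by (auto simp: erase_def sing_def pointwise)

text \<open>The pair holds the chosen intersection demanded from the argument and the codomain
  returned. As an element of a product monoid it can be summed by \<open>gather\<close>, which
  yields the premises and the conclusion of \<open>arrE\<close>.\<close>

definition arrow_elim :: "'b ity \<times> 'b uty \<Rightarrow> 'b ty \<Rightarrow> bool" where
  "arrow_elim r \<sigma> \<longleftrightarrow> (\<exists>I. \<sigma> = Arr I (snd r) \<and> snd r \<noteq> {#} \<and> ichoice I (fst r))"

lemma arrow_elim_Arr [simp]: "arrow_elim (J, W) (Arr I U) \<longleftrightarrow> W = U \<and> U \<noteq> {#} \<and> ichoice I J"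
  by (auto simp: arrow_elim_def)

lemma ichoice_nonempty: "ichoice I J \<Longrightarrow> J \<noteq> {#}"
  by (auto simp: ichoice_def split: if_splits)

text \<open>A single arrow already contributes a non-empty choice to \<open>J\<close> and a
  non-empty codomain to \<open>W\<close>.\<close>

lemma gather_arrow_elim_nonempty:
  "gather arrow_elim (J, W) V \<Longrightarrow> V \<noteq> {#} \<Longrightarrow> J \<noteq> {#} \<and> W \<noteq> {#}"
  by (erule gather.cases) (auto simp: arrow_elim_def dest: ichoice_nonempty)

text \<open>The arity of an arrow is that of its codomain plus one; its domain contributes
  nothing.\<close>

lemma ar_u_arrow_elim: "gather arrow_elim r V \<Longrightarrow> ar_u V = size V + ar_u (snd r)"
  by (induction rule: gather.induct) (auto simp: arrow_elim_def ar_u_def)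

lemma gather_arrow_elim_sum:
  assumes "\<And>k. k < n \<Longrightarrow> U k \<noteq> {#}" "\<And>k. k < n \<Longrightarrow> ichoice (I k) (J k)"
  shows "gather arrow_elim (\<Sum>k<n. J k, \<Sum>k<n. U k)
    (image_mset (\<lambda>k. Arr (I k) (U k)) (mset_set {..<n::nat}))"
  using gather_sum[of n arrow_elim "\<lambda>k. (J k, U k)" "\<lambda>k. Arr (I k) (U k)"] assms
  by (simp add: sum_prod)


text \<open>A type \<open>\<sigma>\<close> of a replaced name \<open>\<alpha>\<close> is an arrow, to be eliminated with arguments obtained from the
  resource \<open>s'\<close>; its codomain \<open>W\<close> is then recorded by \<open>h\<close> as a type of \<open>\<alpha>\<close>.\<close>

definition arg_elim ::
  "('b uty \<Rightarrow> 'r::comm_monoid_add) \<Rightarrow> ('r \<Rightarrow> 'b uty \<Rightarrow> bool) \<Rightarrow> 'r \<Rightarrow> 'b ty \<Rightarrow> bool" where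
  "arg_elim h P s \<sigma> \<longleftrightarrow> (\<exists>J W s'. s = h W + s' \<and> arrow_elim (J, W) \<sigma> \<and> gather P s' J)"

text \<open>Additivity of \<open>h\<close> lets the codomains recorded arrow by arrow be recorded at
  once, so one elimination of all of \<open>V\<close> is the same as eliminating its members
  separately.\<close>

lemma gather_arg_elim:
  assumes h: "h {#} = 0" "\<And>U V. h (U + V) = h U + h V"
  shows "gather (arg_elim h P) s V \<longleftrightarrow>
    (\<exists>J W s'. s = h W + s' \<and> gather arrow_elim (J, W) V \<and> gather P s' J)"
proof
  assume "gather (arg_elim h P) s V"
  then show "\<exists>J W s'. s = h W + s' \<and> gather arrow_elim (J, W) V \<and> gather P s' J"
  proof induction
    case empty
    then show ?case by (intro exI[of _ "{#}"] exI[of _ 0]) (auto simp: h zero_prod_def)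
  next
    case (add r \<sigma> s V)
    then obtain J1 W1 r' J2 W2 s' where 1: "r = h W1 + r'" "arrow_elim (J1, W1) \<sigma>" "gather P r' J1"
      "s = h W2 + s'" "gather arrow_elim (J2, W2) V" "gather P s' J2"
      unfolding arg_elim_def by blast
    have "gather arrow_elim (J1 + J2, W1 + W2) (add_mset \<sigma> V)"
      using gather.add[OF 1(2,5)] by simp
    moreover have "r + s = h (W1 + W2) + (r' + s')" using 1 h by (simp add: ac_simps)
    ultimately show ?case using gather_union[OF 1(3,6)] by blast
  qed
next
  assume "\<exists>J W s'. s = h W + s' \<and> gather arrow_elim (J, W) V \<and> gather P s' J"
  then obtain J W s' where "gather arrow_elim (J, W) V" "gather P s' J" "s = h W + s'" by blast
  then show "gather (arg_elim h P) s V"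
  proof (induction "(J, W)" V arbitrary: J W s s' rule: gather.induct)
    case empty
    then show ?case by (auto simp: h zero_prod_def)
  next
    case (add r \<sigma> rs V)
    obtain J1 W1 J2 W2 where r: "r = (J1, W1)" "rs = (J2, W2)" by (metis surj_pair)
    then have JW: "J = J1 + J2" "W = W1 + W2" using add by auto
    then obtain s1 s2 where s: "s' = s1 + s2" "gather P s1 J1" "gather P s2 J2"
      using add.prems gather_unionD by blast
    have "arg_elim h P (h W1 + s1) \<sigma>" using add.hyps r s unfolding arg_elim_def by blast
    moreover have "gather (arg_elim h P) (h W2 + s2) V" using add.hyps(3) r s by blast
    ultimately have "gather (arg_elim h P) ((h W1 + s1) + (h W2 + s2)) (add_mset \<sigma> V)"
      by (rule gather.add)
    then show ?case using JW s add.prems h by (simp add: ac_simps)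
  qed
qed


section \<open>A weighted system with weakening\<close>

type_synonym 'b ctx = "(nat \<Rightarrow> 'b ity) \<times> (nat \<Rightarrow> 'b uty)"

text \<open>Weakening happens at variables, where the surplus weight \<open>m\<close> and the other
  entries are arbitrary. It also absorbs the choice in the rule for \<open>Mu\<close>: name 0
  receives the chosen type \<open>V\<close> itself. Recursion on the object makes inversion a matter
  of unfolding.\<close>

primrec wtyp_t :: "trm \<Rightarrow> nat \<times> 'b ctx \<Rightarrow> 'b uty \<Rightarrow> bool"
  and wtyp_c :: "cmd \<Rightarrow> nat \<times> 'b ctx \<Rightarrow> bool" where
  "wtyp_t (Var x) r U \<longleftrightarrow> (\<exists>m \<Gamma> \<Delta>. r = (Suc m, \<Gamma>, \<Delta>) \<and> U \<noteq> {#} \<and> U \<in># \<Gamma> x)"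
| "wtyp_t (Lam t) r V \<longleftrightarrow>
     (\<exists>m \<Gamma> \<Delta> I U. r = (Suc m, \<Gamma>, \<Delta>) \<and> V = {#Arr I U#} \<and> wtyp_t t (m, ins 0 I \<Gamma>, \<Delta>) U)"
| "wtyp_t (App t u) r W \<longleftrightarrow>
     (\<exists>r1 r2 V J. r = r1 + r2 + (size V, 0) \<and> wtyp_t t r1 V \<and>
        gather arrow_elim (J, W) V \<and> gather (wtyp_t u) r2 J)"
| "wtyp_t (Mu c) r V \<longleftrightarrow>
     (\<exists>m \<Gamma> \<Delta>. r = (Suc m, \<Gamma>, \<Delta>) \<and> V \<noteq> {#} \<and> wtyp_c c (m, \<Gamma>, ins 0 V \<Delta>))"
| "wtyp_c (Named \<gamma> t) r \<longleftrightarrow>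
     (\<exists>r' U. r = r' + (ar_u U, 0, sing \<gamma> U) \<and> wtyp_t t r' U)"

fun wtyp_o :: "obj \<Rightarrow> nat \<times> 'b ctx \<Rightarrow> 'b objty \<Rightarrow> bool" where
  "wtyp_o (Term t) r A \<longleftrightarrow> (\<exists>U. A = UTy U \<and> wtyp_t t r U)"
| "wtyp_o (Cmd c) r A \<longleftrightarrow> A = Hash \<and> wtyp_c c r"

lemma wtyp_nonempty: "wtyp_t t r U \<Longrightarrow> U \<noteq> {#}"
proof (induction t arbitrary: r U rule: trm.induct[where ?P2.0 = "\<lambda>_. True"])
  case (App t u)
  then show ?case using gather_arrow_elim_nonempty by fastforce
qed auto

lemma wtyp_AppI:
  assumes "wtyp_t t (m1, \<rho>1) V" "gather arrow_elim (J, W) V" "gather (wtyp_t u) (m2, \<rho>2) J"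
  shows "wtyp_t (App t u) (m1 + m2 + size V, \<rho>1 + \<rho>2) W"
proof -
  have "(m1 + m2 + size V, \<rho>1 + \<rho>2) = (m1, \<rho>1) + (m2, \<rho>2) + (size V, 0)" by simp
  then show ?thesis using assms unfolding wtyp_t.simps by blast
qed

text \<open>The surplus is sent to the function part of each application until it reaches a
  variable; under a binder it is extended by an empty entry.\<close>

lemma wtyp_weaken:
  "wtyp_t t r U \<Longrightarrow> wtyp_t t (r + s) U"
  "wtyp_c c r \<Longrightarrow> wtyp_c c (r + s)"
proof (induction t and c arbitrary: r s U and r s)
  case (Var x)
  obtain k G D where "s = (k, G, D)" by (metis surj_pair)
  with Var show ?case by (auto simp: plus_fun_apply)
next
  case (Lam t)
  then obtain m \<Gamma> \<Delta> I V where *: "r = (Suc m, \<Gamma>, \<Delta>)" "U = {#Arr I V#}" "wtyp_t t (m, ins 0 I \<Gamma>, \<Delta>) V"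
    by auto
  obtain k G D where s: "s = (k, G, D)" by (metis surj_pair)
  have "wtyp_t t ((m, ins 0 I \<Gamma>, \<Delta>) + (k, ins 0 {#} G, D)) V" using Lam.IH * by blast
  then show ?case using * s ins_add[of 0 I "{#}" \<Gamma> G] by auto
next
  case (App t u)
  then obtain r1 r2 V J where *: "r = r1 + r2 + (size V, 0)" "wtyp_t t r1 V"
    "gather arrow_elim (J, U) V" "gather (wtyp_t u) r2 J" by auto
  have "r + s = (r1 + s) + r2 + (size V, 0)" using * by (simp add: ac_simps)
  then show ?case using * App.IH(1) unfolding wtyp_t.simps by blast
next
  case (Mu c)
  then obtain m \<Gamma> \<Delta> where *: "r = (Suc m, \<Gamma>, \<Delta>)" "U \<noteq> {#}" "wtyp_c c (m, \<Gamma>, ins 0 U \<Delta>)"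
    by auto
  obtain k G D where s: "s = (k, G, D)" by (metis surj_pair)
  have "wtyp_c c ((m, \<Gamma>, ins 0 U \<Delta>) + (k, G, ins 0 {#} D))" using Mu.IH * by blast
  then show ?case using * s ins_add[of 0 U "{#}" \<Delta> D] by auto
next
  case (Named \<gamma> t)
  then obtain r' V where *: "r = r' + (ar_u V, 0, sing \<gamma> V)" "wtyp_t t r' V" by auto
  have "r + s = (r' + s) + (ar_u V, 0, sing \<gamma> V)" using * by (simp add: ac_simps)
  then show ?case using * Named.IH unfolding wtyp_c.simps by blast
qed

section \<open>Renaming, substitution and replacement in the weighted system\<close>

lemma wtyp_shift_var:
  "wtyp_t t r U \<Longrightarrow> wtyp_t (shift_var_t k t) (apsnd (apfst (ins k {#})) r) U"
  "wtyp_c c r \<Longrightarrow> wtyp_c (shift_var_c k c) (apsnd (apfst (ins k {#})) r)"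
proof (induction t and c arbitrary: k r U and k r)
  case (Var x)
  then show ?case by (auto simp: ins_def)
next
  case (Lam t)
  then show ?case using Lam.IH[of "(_, ins 0 _ _, _)" _ "Suc k"] by (auto simp: ins_Suc_ins_0)
next
  case (App t u)
  let ?f = "apsnd (apfst (ins k {#})) :: nat \<times> 'a ctx \<Rightarrow> _"
  have f: "?f 0 = 0" "\<And>r s. ?f (r + s) = ?f r + ?f s"
    by (auto simp: zero_prod_def ins_zero_add split: prod.splits)
  from App obtain r1 r2 V J where *: "r = r1 + r2 + (size V, 0)" "wtyp_t t r1 V"
    "gather arrow_elim (J, U) V" "gather (wtyp_t u) r2 J" by auto
  have "gather (wtyp_t (shift_var_t k u)) (?f r2) J"
    using *(4) f App.IH(2) by (rule gather_map)
  moreover have "?f r = ?f r1 + ?f r2 + (size V, 0)" using * f by (simp add: zero_prod_def)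
  ultimately show ?case using * App.IH(1) unfolding wtyp_t.simps shift_var_t.simps by blast
next
  case (Mu c)
  then show ?case using Mu.IH[of "(_, _, ins 0 _ _)"] by auto
next
  case (Named \<gamma> t)
  then obtain m \<Gamma> \<Delta> V where *: "r = (m, \<Gamma>, \<Delta>) + (ar_u V, 0, sing \<gamma> V)" "wtyp_t t (m, \<Gamma>, \<Delta>) V"
    by (auto simp del: add_Pair)
  have "apsnd (apfst (ins k {#})) r =
    apsnd (apfst (ins k {#})) (m, \<Gamma>, \<Delta>) + (ar_u V, 0, sing \<gamma> V)"
    using * by (simp add: ins_zero_add)
  then show ?case using Named.IH[OF *(2), of k] unfolding wtyp_c.simps shift_var_c.simps by blast
qed

lemma wtyp_shift_name:
  "wtyp_t t r U \<Longrightarrow> wtyp_t (shift_name_t k t) (apsnd (apsnd (ins k {#})) r) U"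
  "wtyp_c c r \<Longrightarrow> wtyp_c (shift_name_c k c) (apsnd (apsnd (ins k {#})) r)"
proof (induction t and c arbitrary: k r U and k r)
  case (Var x)
  then show ?case by auto
next
  case (Lam t)
  then show ?case using Lam.IH[of "(_, ins 0 _ _, _)" _ "k"] by auto
next
  case (App t u)
  let ?f = "apsnd (apsnd (ins k {#})) :: nat \<times> 'a ctx \<Rightarrow> _"
  have f: "?f 0 = 0" "\<And>r s. ?f (r + s) = ?f r + ?f s"
    by (auto simp: zero_prod_def ins_zero_add split: prod.splits)
  from App obtain r1 r2 V J where *: "r = r1 + r2 + (size V, 0)" "wtyp_t t r1 V"
    "gather arrow_elim (J, U) V" "gather (wtyp_t u) r2 J" by auto
  have "gather (wtyp_t (shift_name_t k u)) (?f r2) J"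
    using *(4) f App.IH(2) by (rule gather_map)
  moreover have "?f r = ?f r1 + ?f r2 + (size V, 0)" using * f by (simp add: zero_prod_def)
  ultimately show ?case using * App.IH(1) unfolding wtyp_t.simps shift_name_t.simps by blast
next
  case (Mu c)
  then show ?case using Mu.IH[of "(_, _, ins 0 _ _)" "Suc k"] by (auto simp: ins_Suc_ins_0)
next
  case (Named \<gamma> t)
  then obtain m \<Gamma> \<Delta> V where *: "r = (m, \<Gamma>, \<Delta>) + (ar_u V, 0, sing \<gamma> V)" "wtyp_t t (m, \<Gamma>, \<Delta>) V"
    by (auto simp del: add_Pair)
  let ?\<gamma> = "if \<gamma> < k then \<gamma> else Suc \<gamma>"
  have "apsnd (apsnd (ins k {#})) r =
    apsnd (apsnd (ins k {#})) (m, \<Gamma>, \<Delta>) + (ar_u V, 0, sing ?\<gamma> V)"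
    using * by (simp add: ins_zero_add ins_sing)
  then show ?case using Named.IH[OF *(2), of k] unfolding wtyp_c.simps shift_name_c.simps by blast
qed

text \<open>Each occurrence of \<open>x\<close> is replaced by a derivation from its share of
  \<open>s\<close>. No weight is saved here; the strict decrease of a beta step comes from its
  abstraction and application.\<close>

lemma wtyp_subst:
  "wtyp_t t r U \<Longrightarrow> gather (wtyp_t u) s (fst (snd r) x) \<Longrightarrow>
    wtyp_t (subst_t x u t) (apsnd (apfst (del x)) r + s) U"
  "wtyp_c c r \<Longrightarrow> gather (wtyp_t u) s (fst (snd r) x) \<Longrightarrow>
    wtyp_c (subst_c x u c) (apsnd (apfst (del x)) r + s)"
proof (induction t and c arbitrary: x u r s U and x u r s)
  case (Var i)
  then obtain m \<Gamma> \<Delta> where r: "r = (Suc m, \<Gamma>, \<Delta>)" "U \<noteq> {#}" "U \<in># \<Gamma> i" by auto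
  obtain k G D where s: "s = (k, G, D)" by (metis surj_pair)
  show ?case
  proof (cases "i = x")
    case True
    then obtain J where "\<Gamma> x = add_mset U J" using r multi_member_split by metis
    \<comment> \<open>One derivation of \<open>u\<close> with the type \<open>U\<close> of this
      occurrence is used; the rest of \<open>s\<close> is absorbed by weakening.\<close>
    then have "gather (wtyp_t u) s (add_mset U J)" using Var.prems(2) r by simp
    from gather_add_msetD[OF this] obtain s1 s2 where "s = s1 + s2" "wtyp_t u s1 U" by blast
    then have "wtyp_t u (s1 + (s2 + apsnd (apfst (del x)) r)) U"
      using wtyp_weaken by blast
    moreover have "s1 + (s2 + apsnd (apfst (del x)) r) =
        apsnd (apfst (del x)) r + s"
      unfolding \<open>s = s1 + s2\<close> by (simp only: ac_simps)
    ultimately have "wtyp_t u (apsnd (apfst (del x)) r + s) U" by (simp only:)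
    then show ?thesis using True by (simp only: subst_t.simps less_irrefl if_True if_False refl)
  next
    case False
    then show ?thesis using r s by (auto simp: del_def plus_fun_apply)
  qed
next
  case (Lam t)
  then obtain m \<Gamma> \<Delta> I V where *: "r = (Suc m, \<Gamma>, \<Delta>)" "U = {#Arr I V#}" "wtyp_t t (m, ins 0 I \<Gamma>, \<Delta>) V"
    by auto
  obtain k G D where s: "s = (k, G, D)" by (metis surj_pair)
  let ?f = "apsnd (apfst (ins 0 {#})) :: nat \<times> 'a ctx \<Rightarrow> _"
  have "gather (wtyp_t (shift_var_t 0 u)) (?f s) (\<Gamma> x)"
    by (rule gather_map[of "wtyp_t u"])
      (use Lam.prems * wtyp_shift_var in \<open>auto simp: zero_prod_def ins_zero_add\<close>)
  then have "wtyp_t (subst_t (Suc x) (shift_var_t 0 u) t)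
    (apsnd (apfst (del (Suc x))) (m, ins 0 I \<Gamma>, \<Delta>) + ?f s) V"
    using * by (intro Lam.IH) auto
  then show ?case using * s by (auto simp: del_Suc_ins_0 ins_add[symmetric])
next
  case (App t v)
  let ?f = "apsnd (apfst (del x)) :: nat \<times> 'a ctx \<Rightarrow> _"
  have f: "?f 0 = 0" "\<And>r s. ?f (r + s) = ?f r + ?f s"
    by (auto simp: zero_prod_def del_add)
  from App obtain r1 r2 V J where *: "r = r1 + r2 + (size V, 0)" "wtyp_t t r1 V"
    "gather arrow_elim (J, U) V" "gather (wtyp_t v) r2 J" by auto
  then obtain s1 s2 where s: "s = s1 + s2" "gather (wtyp_t u) s1 (fst (snd r1) x)"
    "gather (wtyp_t u) s2 (fst (snd r2) x)"
    using App.prems gather_unionD[of "wtyp_t u" s "fst (snd r1) x" "fst (snd r2) x"]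
    by (auto simp: plus_fun_apply)
  have "gather (wtyp_t (subst_t x u v)) (?f r2 + s2) J"
    by (rule gather_absorb[where g = "\<lambda>r. fst (snd r) x", OF *(4) s(3)])
      (use f App.IH(2) in \<open>auto simp: plus_fun_apply zero_fun_apply\<close>)
  moreover have "?f r + s = (?f r1 + s1) + (?f r2 + s2) + (size V, 0)"
    using * s f by (simp add: zero_prod_def ac_simps)
  ultimately show ?case using * s App.IH(1) unfolding wtyp_t.simps subst_t.simps by blast
next
  case (Mu c)
  then obtain m \<Gamma> \<Delta> where *: "r = (Suc m, \<Gamma>, \<Delta>)" "U \<noteq> {#}" "wtyp_c c (m, \<Gamma>, ins 0 U \<Delta>)"
    by auto
  obtain k G D where s: "s = (k, G, D)" by (metis surj_pair)
  let ?f = "apsnd (apsnd (ins 0 {#})) :: nat \<times> 'a ctx \<Rightarrow> _"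
  have "gather (wtyp_t (shift_name_t 0 u)) (?f s) (\<Gamma> x)"
    by (rule gather_map[of "wtyp_t u"])
      (use Mu.prems * wtyp_shift_name in \<open>auto simp: zero_prod_def ins_zero_add\<close>)
  then have "wtyp_c (subst_c x (shift_name_t 0 u) c)
    (apsnd (apfst (del x)) (m, \<Gamma>, ins 0 U \<Delta>) + ?f s)"
    using * by (intro Mu.IH) auto
  then show ?case using * s by (auto simp: ins_add[symmetric])
next
  case (Named \<gamma> t)
  then obtain r' V where *: "r = r' + (ar_u V, 0, sing \<gamma> V)" "wtyp_t t r' V"
    by auto
  then have "wtyp_t (subst_t x u t) (apsnd (apfst (del x)) r' + s) V"
    using Named by auto
  moreover have "apsnd (apfst (del x)) r + s =
     (apsnd (apfst (del x)) r' + s) + (ar_u V, 0, sing \<gamma> V)"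
    using * by (cases r') (simp add: del_add ac_simps)
  ultimately show ?case unfolding wtyp_c.simps subst_c.simps by blast
qed


text \<open>Carries the arguments under a binder. The recorders \<open>h\<close> and
  \<open>h'\<close> may differ because the replaced name becomes \<open>Suc \<alpha>\<close> under a
  mu-abstraction.\<close>

lemma gather_arg_elim_map:
  assumes "gather (arg_elim h P) s V" "f 0 = 0" "\<And>r s. f (r + s) = f r + f s"
    "\<And>W. f (h W) = h' W" "\<And>r U. P r U \<Longrightarrow> Q (f r) U"
  shows "gather (arg_elim h' Q) (f s) V"
proof (rule gather_map[of _ s V f, OF assms(1-3)])
  fix r \<sigma> assume "arg_elim h P r \<sigma>"
  then obtain J W s' where 1: "r = h W + s'" "arrow_elim (J, W) \<sigma>" "gather P s' J"
    by (auto simp: arg_elim_def)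
  have "gather Q (f s') J"
    by (rule gather_map[of P s' J f Q, OF 1(3) assms(2,3,5)])
  moreover have "f (h W + s') = h' W + f s'" using assms(3,4) by simp
  ultimately show "arg_elim h' Q (f r) \<sigma>" using 1 unfolding arg_elim_def by metis
qed

text \<open>The weights add up exactly: by \<open>ar_u_arrow_elim\<close>, replacing a type \<open>V\<close> of \<open>\<alpha>\<close> by the union \<open>W\<close> of its
  codomains lowers the arity in the naming rule by \<open>size V\<close>, which is what the new application costs.\<close>

lemma wtyp_repl:
  "wtyp_t t r U \<Longrightarrow> gather (arg_elim (\<lambda>W. (0, 0, sing \<alpha> W)) (wtyp_t u)) s (snd (snd r) \<alpha>) \<Longrightarrow>
    wtyp_t (repl_t \<alpha> u t) (apsnd (apsnd (erase \<alpha>)) r + s) U"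
  "wtyp_c c r \<Longrightarrow> gather (arg_elim (\<lambda>W. (0, 0, sing \<alpha> W)) (wtyp_t u)) s (snd (snd r) \<alpha>) \<Longrightarrow>
    wtyp_c (repl_c \<alpha> u c) (apsnd (apsnd (erase \<alpha>)) r + s)"
proof (induction t and c arbitrary: \<alpha> u r s U and \<alpha> u r s)
  case (Var i)
  then obtain m \<Gamma> \<Delta> where r: "r = (Suc m, \<Gamma>, \<Delta>)" "U \<noteq> {#}" "U \<in># \<Gamma> i" by auto
  obtain k G D where s: "s = (k, G, D)" by (metis surj_pair)
  show ?case using r s by (auto simp: plus_fun_apply)
next
  case (Lam t)
  then obtain m \<Gamma> \<Delta> I V where *: "r = (Suc m, \<Gamma>, \<Delta>)" "U = {#Arr I V#}" "wtyp_t t (m, ins 0 I \<Gamma>, \<Delta>) V"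
    by auto
  obtain k G D where s: "s = (k, G, D)" by (metis surj_pair)
  let ?f = "apsnd (apfst (ins 0 {#})) :: nat \<times> 'a ctx \<Rightarrow> _"
  have "gather (arg_elim (\<lambda>W. (0, 0, sing \<alpha> W)) (wtyp_t (shift_var_t 0 u))) (?f s) (\<Delta> \<alpha>)"
  proof (rule gather_arg_elim_map[of _ "wtyp_t u" _ _ ?f])
    show "gather (arg_elim (\<lambda>W. (0, 0, sing \<alpha> W)) (wtyp_t u)) s (\<Delta> \<alpha>)"
      using Lam.prems(2) * by (simp only: fst_conv snd_conv)
  qed (use wtyp_shift_var in \<open>auto simp: zero_prod_def ins_zero_add\<close>)
  then have "wtyp_t (repl_t \<alpha> (shift_var_t 0 u) t)
    (apsnd (apsnd (erase \<alpha>)) (m, ins 0 I \<Gamma>, \<Delta>) + ?f s) V"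
    using * by (intro Lam.IH) auto
  then show ?case using * s by (auto simp: ins_add[symmetric])
next
  case (App t v)
  let ?f = "apsnd (apsnd (erase \<alpha>)) :: nat \<times> 'a ctx \<Rightarrow> _"
  let ?A = "arg_elim (\<lambda>W. (0, 0, sing \<alpha> W)) (wtyp_t u)"
  have f: "?f 0 = 0" "\<And>r s. ?f (r + s) = ?f r + ?f s"
    by (auto simp: zero_prod_def erase_add)
  from App obtain r1 r2 V J where *: "r = r1 + r2 + (size V, 0)" "wtyp_t t r1 V"
    "gather arrow_elim (J, U) V" "gather (wtyp_t v) r2 J" by auto
  then have "gather ?A s (snd (snd r1) \<alpha> + snd (snd r2) \<alpha>)"
    using App.prems by (simp add: plus_fun_apply)
  from gather_unionD[OF this] obtain s1 s2 where s: "s = s1 + s2"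
    "gather ?A s1 (snd (snd r1) \<alpha>)" "gather ?A s2 (snd (snd r2) \<alpha>)"
    by blast
  have "gather (wtyp_t (repl_t \<alpha> u v)) (?f r2 + s2) J"
    by (rule gather_absorb[where P = "wtyp_t v" and Q = ?A and g = "\<lambda>r. snd (snd r) \<alpha>" and f = ?f,
        OF *(4) s(3) _ _ f(1) f(2)])
      (erule (1) App.IH(2) | simp add: plus_fun_apply zero_fun_apply)+
  moreover have "?f r + s = (?f r1 + s1) + (?f r2 + s2) + (size V, 0)"
    using * s f by (simp add: zero_prod_def ac_simps)
  ultimately show ?case using * s App.IH(1) unfolding wtyp_t.simps repl_t.simps by blast
next
  case (Mu c)
  then obtain m \<Gamma> \<Delta> where *: "r = (Suc m, \<Gamma>, \<Delta>)" "U \<noteq> {#}" "wtyp_c c (m, \<Gamma>, ins 0 U \<Delta>)"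
    by auto
  obtain k G D where s: "s = (k, G, D)" by (metis surj_pair)
  let ?f = "apsnd (apsnd (ins 0 {#})) :: nat \<times> 'a ctx \<Rightarrow> _"
  have "gather (arg_elim (\<lambda>W. (0, 0, sing (Suc \<alpha>) W)) (wtyp_t (shift_name_t 0 u))) (?f s) (\<Delta> \<alpha>)"
  proof (rule gather_arg_elim_map[of _ "wtyp_t u" _ _ ?f])
    show "gather (arg_elim (\<lambda>W. (0, 0, sing \<alpha> W)) (wtyp_t u)) s (\<Delta> \<alpha>)"
      using Mu.prems(2) * by (simp only: fst_conv snd_conv)
  qed (use wtyp_shift_name in \<open>auto simp: zero_prod_def ins_zero_add ins_sing\<close>)
  then have "wtyp_c (repl_c (Suc \<alpha>) (shift_name_t 0 u) c)
    (apsnd (apsnd (erase (Suc \<alpha>))) (m, \<Gamma>, ins 0 U \<Delta>) + ?f s)"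
    using * by (intro Mu.IH) auto
  then show ?case using * s by (auto simp: ins_add[symmetric])
next
  case (Named \<gamma> t)
  let ?f = "apsnd (apsnd (erase \<alpha>)) :: nat \<times> 'a ctx \<Rightarrow> _"
  let ?h = "\<lambda>W. (0, 0, sing \<alpha> W) :: nat \<times> 'a ctx"
  let ?A = "arg_elim ?h (wtyp_t u)"
  from Named obtain r' V where *: "r = r' + (ar_u V, 0, sing \<gamma> V)" "wtyp_t t r' V"
    by auto
  obtain m' \<Gamma>' \<Delta>' where r': "r' = (m', \<Gamma>', \<Delta>')" by (metis surj_pair)
  show ?case
  proof (cases "\<gamma> = \<alpha>")
    case False
    then have "snd (snd r) \<alpha> = snd (snd r') \<alpha>" using * by (simp add: sing_def plus_fun_apply)
    with Named.prems(2) have "wtyp_t (repl_t \<alpha> u t) (?f r' + s) V"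
      by (intro Named.IH *) simp
    moreover have "?f r + s = (?f r' + s) + (ar_u V, 0, sing \<gamma> V)"
      using * r' False by (cases s) (auto simp: erase_add erase_sing ac_simps)
    ultimately have "wtyp_c (Named \<gamma> (repl_t \<alpha> u t)) (?f r + s)"
      unfolding wtyp_c.simps by blast
    then show ?thesis using False by (simp del: wtyp_c.simps)
  next
    case True
    \<comment> \<open>The type \<open>V\<close> of this naming joins the demand on \<alpha>: one
      share of \<open>s\<close> serves the namings inside \<open>t\<close>, the other serves this
      one.\<close>
    have "gather ?A s (\<Delta>' \<alpha> + V)"
      using Named.prems * r' True by (simp add: sing_def plus_fun_apply)
    from gather_unionD[OF this] obtain s1 s2 where
      s: "s = s1 + s2" "gather ?A s1 (\<Delta>' \<alpha>)" "gather ?A s2 V" by blast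
    moreover have "?h {#} = 0" "\<And>U V. ?h (U + V) = ?h U + ?h V"
      by (auto simp: sing_def pointwise zero_prod_def)
    ultimately obtain J W s3 where W: "s2 = ?h W + s3" "gather arrow_elim (J, W) V"
      "gather (wtyp_t u) s3 J" using gather_arg_elim[of ?h] by metis
    have "wtyp_t (repl_t \<alpha> u t) (?f r' + s1) V"
      by (intro Named.IH *) (use s r' in \<open>simp only: snd_conv\<close>)
    then have "wtyp_t (App (repl_t \<alpha> u t) u) ((?f r' + s1) + s3 + (size V, 0)) W"
      using W unfolding wtyp_t.simps by blast
    moreover have "?f r + s = ((?f r' + s1) + s3 + (size V, 0)) + (ar_u W, 0, sing \<alpha> W)"
      using * r' s W True ar_u_arrow_elim[OF W(2)]
      by (cases s1, cases s3) (auto simp: erase_add erase_sing zero_prod_def ac_simps)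
    ultimately have "wtyp_c (Named \<alpha> (App (repl_t \<alpha> u t) u)) (?f r + s)"
      unfolding wtyp_c.simps by metis
    then show ?thesis using True by (simp del: wtyp_c.simps)
  qed
qed

section \<open>Subject reduction with strictly decreasing weight\<close>

lemma gather_wtyp_decrease:
  assumes "gather P (m, \<rho>) J" "J \<noteq> {#}"
    and "\<And>m \<rho> U. P (m, \<rho>) U \<Longrightarrow> \<exists>m'<m. Q (m', \<rho>) U"
  shows "\<exists>m'<(m::nat). gather Q (m', \<rho> :: 'r::comm_monoid_add) J"
proof -
  \<comment> \<open>One distinguished member makes the total decrease strict; for the others a weak
    inequality is enough.\<close>
  obtain U K where J: "J = add_mset U K" using assms(2) by (cases J) auto
  from gather_add_msetD[OF assms(1)[unfolded J]] obtain m1 \<rho>1 m2 \<rho>2 where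
    r: "(m, \<rho>) = (m1, \<rho>1) + (m2, \<rho>2)" "P (m1, \<rho>1) U" "gather P (m2, \<rho>2) K" by auto
  obtain n1 where n1: "n1 < m1" "Q (n1, \<rho>1) U" using r assms(3) by blast
  have "\<exists>r'. (fst r' \<le> m2 \<and> snd r' = \<rho>2) \<and> gather Q r' K"
    using gather_rel[OF r(3), of "\<lambda>r r'. fst r' \<le> fst r \<and> snd r' = snd r" Q] assms(3)
    by (fastforce intro: less_imp_le)
  then obtain n2 where "n2 \<le> m2" "gather Q (n2, \<rho>2) K" by auto
  then have "gather Q (n1 + n2, \<rho>) J" "n1 + n2 < m"
    using gather.add[of Q "(n1, \<rho>1)" U "(n2, \<rho>2)" K] n1 r J by auto
  then show ?thesis by blast
qed

text \<open>Because the type and the assignments are kept exactly, the decrease passes through every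
  context, including binders whose types record entries of the assignments.\<close>

lemma subject_reduction:
  assumes "red ob ob'" "wtyp_o ob (m, \<rho>) A"
  shows "\<exists>m'<m. wtyp_o ob' (m', \<rho>) A"
  using assms
proof (induction arbitrary: m \<rho> A)
  case (beta t u)
  then obtain W r1 r2 V J where *: "A = UTy W" "(m, \<rho>) = r1 + r2 + (size V, 0)"
    "wtyp_t (Lam t) r1 V" "gather arrow_elim (J, W) V" "gather (wtyp_t u) r2 J"
    unfolding wtyp_o.simps wtyp_t.simps(3) by blast
  then obtain m1 \<Gamma> \<Delta> I U where 1: "r1 = (Suc m1, \<Gamma>, \<Delta>)" "V = {#Arr I U#}"
    "wtyp_t t (m1, ins 0 I \<Gamma>, \<Delta>) U" by auto
  then have "W = U" "ichoice I J" using * by auto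
  \<comment> \<open>The choice only adds: \<open>K\<close> is empty, or the one extra type demanded
    when \<open>I\<close> is empty. Its derivations are absorbed by weakening.\<close>
  then obtain K where "J = I + K" by (auto simp: ichoice_def split: if_splits)
  with *(5) have "gather (wtyp_t u) r2 (I + K)" by simp
  from gather_unionD[OF this] obtain s1 s2 where s: "r2 = s1 + s2" "gather (wtyp_t u) s1 I"
    by blast
  have "wtyp_t (subst_t 0 u t)
      (apsnd (apfst (del 0)) (m1, ins 0 I \<Gamma>, \<Delta>) + s1) U"
    using 1 s by (intro wtyp_subst(1)) auto
  then have "wtyp_t (subst_t 0 u t) ((m1, \<Gamma>, \<Delta>) + s1 + s2) U"
    using wtyp_weaken(1) by fastforce
  \<comment> \<open>The two lost units are that of the abstraction and \<open>size V = 1\<close> of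
    the application.\<close>
  moreover have "(m1, \<Gamma>, \<Delta>) + s1 + s2 = (m - 2, \<rho>)" "m - 2 < m"
    using * 1 s by (cases s1, cases s2, auto simp: zero_prod_def ac_simps)+
  ultimately show ?case using * \<open>W = U\<close> by auto
next
  case (mu c u)
  then obtain W r1 r2 V J where *: "A = UTy W" "(m, \<rho>) = r1 + r2 + (size V, 0)"
    "wtyp_t (Mu c) r1 V" "gather arrow_elim (J, W) V" "gather (wtyp_t u) r2 J"
    unfolding wtyp_o.simps wtyp_t.simps(3) by blast
  then obtain m1 \<Gamma> \<Delta> where 1: "r1 = (Suc m1, \<Gamma>, \<Delta>)" "V \<noteq> {#}"
    "wtyp_c c (m1, \<Gamma>, ins 0 V \<Delta>)" by auto
  obtain m2 G D where r2: "r2 = (m2, G, D)" by (metis surj_pair)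
  let ?f = "apsnd (apsnd (ins 0 {#})) :: nat \<times> 'a ctx \<Rightarrow> _"
  let ?h = "\<lambda>W. (0, 0, sing 0 W) :: nat \<times> 'a ctx"
  have "gather (wtyp_t (shift_name_t 0 u)) (?f r2) J"
    by (rule gather_map[of "wtyp_t u"])
      (use * wtyp_shift_name in \<open>auto simp: zero_prod_def ins_zero_add\<close>)
  moreover have "?h {#} = 0" "\<And>U V. ?h (U + V) = ?h U + ?h V"
    by (auto simp: sing_def pointwise zero_prod_def)
  \<comment> \<open>Name 0 trades its arrows \<open>V\<close> for their codomains \<open>W\<close>;
    the derivations of the argument, renamed to live under the binder, pay for the new
    applications.\<close>
  ultimately have "gather (arg_elim ?h (wtyp_t (shift_name_t 0 u))) (?h W + ?f r2) V"
    using gather_arg_elim[of ?h] *(4) by metis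
  then have "wtyp_c (repl_c 0 (shift_name_t 0 u) c)
    (apsnd (apsnd (erase 0)) (m1, \<Gamma>, ins 0 V \<Delta>) + (?h W + ?f r2))"
    using 1 by (intro wtyp_repl(2)) auto
  moreover have "ins 0 {#} \<Delta> + (sing 0 W + ins 0 {#} D) = ins 0 W (\<Delta> + D)"
    by (auto simp: ins_def sing_def pointwise)
  ultimately have "wtyp_c (repl_c 0 (shift_name_t 0 u) c) (m1 + m2, \<Gamma> + G, ins 0 W (\<Delta> + D))"
    using r2 by simp
  moreover have "W \<noteq> {#}" using gather_arrow_elim_nonempty *(4) 1(2) by blast
  \<comment> \<open>The mu-abstraction keeps its unit, so the loss is \<open>size V\<close>,
    positive because \<open>V\<close> is non-empty.\<close>
  moreover have "\<rho> = (\<Gamma> + G, \<Delta> + D)" "Suc (m1 + m2) < m"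
    using * 1 r2 by (auto simp: zero_prod_def nonempty_has_size)
  ultimately show ?case using * by auto
next
  case (Lam t t')
  then obtain m1 \<Gamma> \<Delta> I U where 1: "m = Suc m1" "\<rho> = (\<Gamma>, \<Delta>)" "A = UTy {#Arr I U#}"
    "wtyp_t t (m1, ins 0 I \<Gamma>, \<Delta>) U" by auto
  then obtain m2 where "m2 < m1" "wtyp_t t' (m2, ins 0 I \<Gamma>, \<Delta>) U"
    using Lam.IH[of m1 "(ins 0 I \<Gamma>, \<Delta>)" "UTy U"] by auto
  then show ?case using 1 by (intro exI[of _ "Suc m2"]) auto
next
  case (AppL t t' u)
  then obtain W m1 \<rho>1 m2 \<rho>2 V J where *: "A = UTy W" "m = m1 + m2 + size V" "\<rho> = \<rho>1 + \<rho>2"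
    "wtyp_t t (m1, \<rho>1) V" "gather arrow_elim (J, W) V" "gather (wtyp_t u) (m2, \<rho>2) J"
    by auto
  then obtain m1' where "m1' < m1" "wtyp_t t' (m1', \<rho>1) V" using AppL.IH[of m1 \<rho>1] by auto
  then show ?case using *
    by (intro exI[of _ "m1' + m2 + size V"])
      (auto intro: wtyp_AppI simp del: wtyp_t.simps)
next
  case (AppR u u' t)
  then obtain W m1 \<rho>1 m2 \<rho>2 V J where *: "A = UTy W" "m = m1 + m2 + size V" "\<rho> = \<rho>1 + \<rho>2"
    "wtyp_t t (m1, \<rho>1) V" "gather arrow_elim (J, W) V" "gather (wtyp_t u) (m2, \<rho>2) J"
    by auto
  \<comment> \<open>The choice operator guarantees a derivation of the argument, so a step inside it
    lowers the weight even if the function discards it.\<close>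
  then have "J \<noteq> {#}" using wtyp_nonempty gather_arrow_elim_nonempty by blast
  then obtain m2' where "m2' < m2" "gather (wtyp_t u') (m2', \<rho>2) J"
    using gather_wtyp_decrease[OF *(6), of "wtyp_t u'"] AppR.IH[of _ _ "UTy _"] by auto
  then show ?case using *
    by (intro exI[of _ "m1 + m2' + size V"])
      (auto intro: wtyp_AppI simp del: wtyp_t.simps)
next
  case (Mu c c')
  then obtain m1 \<Gamma> \<Delta> V where 1: "m = Suc m1" "\<rho> = (\<Gamma>, \<Delta>)" "A = UTy V" "V \<noteq> {#}"
    "wtyp_c c (m1, \<Gamma>, ins 0 V \<Delta>)" by auto
  then obtain m2 where "m2 < m1" "wtyp_c c' (m2, \<Gamma>, ins 0 V \<Delta>)"
    using Mu.IH[of m1 "(\<Gamma>, ins 0 V \<Delta>)" Hash] by auto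
  then show ?case using 1 by (intro exI[of _ "Suc m2"]) auto
next
  case (Named t t' \<alpha>)
  then obtain m1 \<rho>1 U where 1: "A = Hash" "m = m1 + ar_u U" "\<rho> = \<rho>1 + (0, sing \<alpha> U)"
    "wtyp_t t (m1, \<rho>1) U" by auto
  then obtain m2 where "m2 < m1" "wtyp_t t' (m2, \<rho>1) U"
    using Named.IH[of m1 \<rho>1 "UTy U"] by auto
  moreover have "(m2 + ar_u U, \<rho>) = (m2, \<rho>1) + (ar_u U, 0, sing \<alpha> U)" using 1 by simp
  ultimately have "wtyp_o (Cmd (Named \<alpha> t')) (m2 + ar_u U, \<rho>) A"
    using 1 unfolding wtyp_o.simps wtyp_c.simps by blast
  then show ?case using 1 \<open>m2 < m1\<close> by (intro exI[of _ "m2 + ar_u U"]) simp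
qed

section \<open>From decreasing weight to length bounds and termination\<close>

lemma wtyp_bounds_reduction:
  assumes "wtyp_o ob (m, \<rho>) A" "(red ^^ n) ob ob'"
  shows "n \<le> m"
  using assms
proof (induction n arbitrary: ob m)
  case (Suc n)
  then obtain ob1 where "red ob ob1" "(red ^^ n) ob1 ob'" by (meson relpowp_Suc_E2)
  then show ?case using subject_reduction[OF _ Suc.prems(1)] Suc.IH by fastforce
qed simp

lemma wtyp_strongly_normalizing:
  assumes "wtyp_o ob (m, \<rho>) A"
  shows "strongly_normalizing ob"
  unfolding strongly_normalizing_def
proof
  assume "\<exists>f. f 0 = ob \<and> (\<forall>i. red (f i) (f (Suc i)))"
  then obtain f where f: "f 0 = ob" "\<And>i. red (f i) (f (Suc i))" by blast
  have "(red ^^ n) (f 0) (f n)" for n by (induction n) (use f in auto)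
  then have "Suc m \<le> m" using wtyp_bounds_reduction assms f by metis
  then show False by simp
qed

text \<open>The weights follow \<open>sz\<close> clause by clause; the arity and the cardinality
  reappear at namings and applications. Weakening enters explicitly only to account for a blind type
  chosen in \<open>hashE\<close>.\<close>

lemma derives_wtyp:
  "derives \<Pi> \<Gamma> ob A \<Delta> \<Longrightarrow> wtyp_o ob (sz \<Pi>, \<Gamma>, \<Delta>) A"
  "derives_aux \<Theta> \<Gamma> t I \<Delta> \<Longrightarrow> gather (wtyp_t t) (sz_aux \<Theta>, \<Gamma>, \<Delta>) I"
proof (induction rule: derives_derives_aux.inducts)
  case (ax U x)
  then show ?case by auto
next
  case (arrI \<Pi> \<Gamma> t U \<Delta>)
  then show ?case by (auto simp: ins_0_eta)
next
  case (hashI \<Pi> \<Gamma> t U \<Delta> \<alpha>)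
  have "\<Delta>(\<alpha> := \<Delta> \<alpha> + U) = \<Delta> + sing \<alpha> U" by (auto simp: sing_def pointwise)
  then have "(sz (HashI U \<Pi>), \<Gamma>, \<Delta>(\<alpha> := \<Delta> \<alpha> + U)) = (sz \<Pi>, \<Gamma>, \<Delta>) + (ar_u U, 0, sing \<alpha> U)"
    by simp
  then show ?case using hashI unfolding wtyp_o.simps wtyp_c.simps by blast
next
  case (hashE \<Pi> \<Gamma> c \<Delta> V)
  \<comment> \<open>\<open>D\<close> is empty, or the blind type chosen when the name has no type;
    adding it costs no weight.\<close>
  then obtain D where V: "V = \<Delta> 0 + D" "V \<noteq> {#}"
    by (auto simp: uchoice_def split: if_splits)
  have "wtyp_c c ((sz \<Pi>, \<Gamma>, \<Delta>) + (0, 0, sing 0 D))" using hashE by (intro wtyp_weaken) auto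
  moreover have "\<Delta> + sing 0 D = ins 0 V (\<lambda>i. \<Delta> (Suc i))"
    using V by (auto simp: sing_def ins_def pointwise)
  ultimately show ?case using V by auto
next
  case (conj n \<Pi> \<Gamma> t U \<Delta>)
  have "gather (wtyp_t t) (\<Sum>k<n. (sz (\<Pi> k), \<Gamma> k, \<Delta> k)) (image_mset U (mset_set {..<n}))"
    by (rule gather_sum) (use conj in auto)
  moreover have "(\<Sum>k<n. \<Gamma> k) = (\<lambda>i. \<Sum>k<n. \<Gamma> k i)" "(\<Sum>k<n. \<Delta> k) = (\<lambda>i. \<Sum>k<n. \<Delta> k i)"
    by (induction n) (auto simp: pointwise)
  moreover have "sum_list (map (sz \<circ> \<Pi>) [0..<n]) = (\<Sum>k<n. sz (\<Pi> k))"
    by (induction n) auto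
  ultimately show ?case by (simp add: sum_prod)
next
  case (arrE \<Pi> \<Gamma>t t I U n \<Delta>t J \<Theta> \<Gamma>u u \<Delta>u)
  have "wtyp_t (App t u) ((sz \<Pi>, \<Gamma>t, \<Delta>t) + (sz_aux \<Theta>, \<Gamma>u, \<Delta>u) +
      (size (image_mset (\<lambda>k. Arr (I k) (U k)) (mset_set {..<n})), 0)) (\<Sum>k<n. U k)"
    unfolding wtyp_t.simps
  proof (intro exI conjI)
    show "wtyp_t t (sz \<Pi>, \<Gamma>t, \<Delta>t) (image_mset (\<lambda>k. Arr (I k) (U k)) (mset_set {..<n}))"
      using arrE by simp
    show "gather (wtyp_t u) (sz_aux \<Theta>, \<Gamma>u, \<Delta>u) (\<Sum>k<n. J k)" using arrE by simp
  qed (use arrE gather_arrow_elim_sum[of n U I J] in auto)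
  then show ?case by (simp add: zero_prod_def plus_fun_def zero_fun_def)
qed


section \<open>Relevant typing and subject expansion\<close>

text \<open>The rules of \<open>derives\<close> without the trees, with assignments as monoid
  elements. Unlike \<open>wtyp_t\<close> it is relevant: a variable gets only the type it
  uses.\<close>

primrec rtyp_t :: "trm \<Rightarrow> 'b ctx \<Rightarrow> 'b uty \<Rightarrow> bool" and rtyp_c :: "cmd \<Rightarrow> 'b ctx \<Rightarrow> bool" where
  "rtyp_t (Var x) r U \<longleftrightarrow> U \<noteq> {#} \<and> r = (sing x {#U#}, 0)"
| "rtyp_t (Lam t) r V \<longleftrightarrow>
     (\<exists>\<Gamma> \<Delta> I U. r = (\<Gamma>, \<Delta>) \<and> V = {#Arr I U#} \<and> rtyp_t t (ins 0 I \<Gamma>, \<Delta>) U)"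
| "rtyp_t (App t u) r W \<longleftrightarrow>
     (\<exists>r1 r2 V J. r = r1 + r2 \<and> rtyp_t t r1 V \<and>
        gather arrow_elim (J, W) V \<and> gather (rtyp_t u) r2 J)"
| "rtyp_t (Mu c) r V \<longleftrightarrow>
     (\<exists>\<Gamma> \<Delta> U. r = (\<Gamma>, \<Delta>) \<and> uchoice U V \<and> rtyp_c c (\<Gamma>, ins 0 U \<Delta>))"
| "rtyp_c (Named \<gamma> t) r \<longleftrightarrow> (\<exists>r' U. r = r' + (0, sing \<gamma> U) \<and> rtyp_t t r' U)"

lemma rtyp_nonempty: "rtyp_t t r U \<Longrightarrow> U \<noteq> {#}"
proof (induction t arbitrary: r U rule: trm.induct[where ?P2.0 = "\<lambda>_. True"])
  case (App t u)
  then show ?case using gather_arrow_elim_nonempty by fastforce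
qed (auto simp: uchoice_def split: if_splits)

lemma gather_derives:
  assumes "gather (\<lambda>r U. \<exists>\<Pi>. derives \<Pi> (fst r) (Term t) (UTy U) (snd r)) r J"
  shows "\<exists>\<Theta>. derives_aux \<Theta> (fst r) t J (snd r)"
proof -
  from assms obtain q n U where *: "r = (\<Sum>k<n. q k)" "J = image_mset U (mset_set {..<n::nat})"
    "\<forall>k<n. \<exists>\<Pi>. derives \<Pi> (fst (q k)) (Term t) (UTy (U k)) (snd (q k))"
    by (rule gather_sumE)
  then obtain \<Pi> where "\<And>k. k < n \<Longrightarrow> derives (\<Pi> k) (fst (q k)) (Term t) (UTy (U k)) (snd (q k))"
    by metis
  from conj[of n, OF this]
  have "derives_aux (Conj (map \<Pi> [0..<n])) (\<lambda>i. \<Sum>k<n. fst (q k) i) t J (\<lambda>i. \<Sum>k<n. snd (q k) i)"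
    using * by simp
  moreover have "fst (\<Sum>k<n. q k) = (\<lambda>i. \<Sum>k<n. fst (q k) i)"
    "snd (\<Sum>k<n. q k) = (\<lambda>i. \<Sum>k<n. snd (q k) i)"
    by (induction n) (auto simp: pointwise)
  ultimately show ?thesis using * by auto
qed

lemma rtyp_derives:
  "rtyp_t t r U \<Longrightarrow> \<exists>\<Pi>. derives \<Pi> (fst r) (Term t) (UTy U) (snd r)"
  "rtyp_c c r \<Longrightarrow> \<exists>\<Pi>. derives \<Pi> (fst r) (Cmd c) Hash (snd r)"
proof (induction t and c arbitrary: r U and r)
  case (Var x)
  have "sing x {#U#} = (\<lambda>_. {#})(x := {#U#})" "(0 :: nat \<Rightarrow> 'a uty) = (\<lambda>_. {#})"
    by (auto simp: sing_def pointwise)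
  then have "derives Ax (sing x {#U#}) (Term (Var x)) (UTy U) 0" using Var ax[of U x] by simp
  then show ?case using Var by auto
next
  case (Lam t)
  then obtain \<Gamma> \<Delta> I V where 1: "r = (\<Gamma>, \<Delta>)" "U = {#Arr I V#}" "rtyp_t t (ins 0 I \<Gamma>, \<Delta>) V"
    by auto
  then obtain \<Pi> where "derives \<Pi> (ins 0 I \<Gamma>) (Term t) (UTy V) \<Delta>" using Lam.IH by fastforce
  from arrI[OF this] show ?case using 1 by auto
next
  case (App t u)
  then obtain r1 r2 V J where 1: "r = r1 + r2" "rtyp_t t r1 V"
    "gather arrow_elim (J, U) V" "gather (rtyp_t u) r2 J" by auto
  \<comment> \<open>The rule \<open>arrE\<close> needs arrows, choices and codomains over one common
    index set.\<close>
  from 1(3) obtain p n \<sigma> where p: "(J, U) = (\<Sum>k<n. p k)"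
    "V = image_mset \<sigma> (mset_set {..<n::nat})" "\<forall>k<n. arrow_elim (p k) (\<sigma> k)"
    by (rule gather_sumE)
  from p(3) obtain I where I: "\<And>k. k < n \<Longrightarrow> \<sigma> k = Arr (I k) (snd (p k))"
    "\<And>k. k < n \<Longrightarrow> snd (p k) \<noteq> {#}" "\<And>k. k < n \<Longrightarrow> ichoice (I k) (fst (p k))"
    unfolding arrow_elim_def by metis
  have V: "V = image_mset (\<lambda>k. Arr (I k) (snd (p k))) (mset_set {..<n})"
    unfolding p(2) by (rule image_mset_cong) (use I in auto)
  have JU: "J = (\<Sum>k<n. fst (p k))" "U = (\<Sum>k<n. snd (p k))"
    using arg_cong[OF p(1), of fst] arg_cong[OF p(1), of snd] by (auto simp: fst_sum snd_sum)
  obtain \<Pi> where \<Pi>: "derives \<Pi> (fst r1) (Term t) (UTy V) (snd r1)" using App.IH(1) 1 by blast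
  have "gather (\<lambda>r U. \<exists>\<Pi>. derives \<Pi> (fst r) (Term u) (UTy U) (snd r)) r2 J"
    using gather_map[OF 1(4), of id] App.IH(2) by auto
  then obtain \<Theta> where \<Theta>: "derives_aux \<Theta> (fst r2) u J (snd r2)" using gather_derives by blast
  have "derives (ArrE n \<Pi> \<Theta>) (\<lambda>i. fst r1 i + fst r2 i) (Term (App t u)) (UTy U)
      (\<lambda>i. snd r1 i + snd r2 i)"
    unfolding JU(2)
    by (rule arrE[where I = I and J = "\<lambda>k. fst (p k)"]) (use \<Pi> \<Theta> V JU I in auto)
  moreover have "fst r = (\<lambda>i. fst r1 i + fst r2 i)" "snd r = (\<lambda>i. snd r1 i + snd r2 i)"
    using 1 by (auto simp: pointwise)
  ultimately show ?case by auto
next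
  case (Mu c)
  then obtain \<Gamma> \<Delta> V where 1: "r = (\<Gamma>, \<Delta>)" "uchoice V U" "rtyp_c c (\<Gamma>, ins 0 V \<Delta>)"
    by auto
  then obtain \<Pi> where "derives \<Pi> \<Gamma> (Cmd c) Hash (ins 0 V \<Delta>)" using Mu.IH by fastforce
  from hashE[OF this, of U] show ?case using 1 by auto
next
  case (Named \<gamma> t)
  then obtain r' U where 1: "r = r' + (0, sing \<gamma> U)" "rtyp_t t r' U" by auto
  then obtain \<Pi> where \<Pi>: "derives \<Pi> (fst r') (Term t) (UTy U) (snd r')" using Named.IH by blast
  have "(snd r')(\<gamma> := snd r' \<gamma> + U) = snd r" by (auto simp: sing_def pointwise 1)
  then show ?case using hashI[OF \<Pi>, of \<gamma>] 1 by auto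
qed

section \<open>Inverting renaming, substitution and replacement\<close>

lemma ins_0_fst_cases: obtains a G D where "q = (ins 0 a G, D)"
  using ins_0_eta[of "fst q"] that by (metis prod.collapse)

lemma ins_0_snd_cases: obtains G a D where "q = (G, ins 0 a D)"
  using ins_0_eta[of "snd q"] that by (metis prod.collapse)

text \<open>Preimages found for the separate members sum to a preimage of the total, since
  \<open>f\<close> is additive.\<close>

lemma gather_unmap:
  assumes "gather Q r J" "f 0 = 0" "\<And>r s. f (r + s) = f r + f s"
    "\<And>r U. Q r U \<Longrightarrow> \<exists>r'. r = f r' \<and> P r' U"
  shows "\<exists>r'. r = f r' \<and> gather P r' J"
  using assms by (intro gather_rel[of Q r J "\<lambda>r r'. r = f r'" P]) auto

lemma gather_arg_elim_unmap:
  assumes "gather (arg_elim h' Q) s V" "f 0 = 0" "\<And>r s. f (r + s) = f r + f s"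
    "\<And>W. f (h W) = h' W" "\<And>r U. Q r U \<Longrightarrow> \<exists>r'. r = f r' \<and> P r' U"
  shows "\<exists>s'. s = f s' \<and> gather (arg_elim h P) s' V"
proof (rule gather_unmap[of _ s V f, OF assms(1-3)])
  fix r \<sigma> assume "arg_elim h' Q r \<sigma>"
  then obtain J W s' where 1: "r = h' W + s'" "arrow_elim (J, W) \<sigma>" "gather Q s' J"
    by (auto simp: arg_elim_def)
  obtain s'' where 2: "s' = f s''" "gather P s'' J"
    using gather_unmap[of Q s' J f P, OF 1(3) assms(2,3,5)] by auto
  have "r = f (h W + s'')" using assms(3,4) 1 2 by simp
  moreover have "arg_elim h P (h W + s'') \<sigma>" using 1 2 unfolding arg_elim_def by metis
  ultimately show "\<exists>r'. r = f r' \<and> arg_elim h P r' \<sigma>" by metis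
qed

text \<open>By relevance, a variable skipped by the shift has an empty entry, so the assignment is
  itself a shifted one.\<close>

lemma rtyp_unshift_var:
  "rtyp_t (shift_var_t k t) r U \<Longrightarrow> \<exists>r'. r = apfst (ins k {#}) r' \<and> rtyp_t t r' U"
  "rtyp_c (shift_var_c k c) r \<Longrightarrow> \<exists>r'. r = apfst (ins k {#}) r' \<and> rtyp_c c r'"
proof (induction t and c arbitrary: k r U and k r)
  case (Var x)
  then show ?case by (intro exI[of _ "(sing x {#U#}, 0)"]) (auto simp: ins_sing)
next
  case (Lam t)
  then obtain \<Gamma> \<Delta> I V where 1: "r = (\<Gamma>, \<Delta>)" "U = {#Arr I V#}"
    "rtyp_t (shift_var_t (Suc k) t) (ins 0 I \<Gamma>, \<Delta>) V" by auto
  from Lam.IH[OF 1(3)] obtain q where 2: "(ins 0 I \<Gamma>, \<Delta>) = apfst (ins (Suc k) {#}) q" "rtyp_t t q V"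
    by blast
  obtain a G D where q: "q = (ins 0 a G, D)" by (rule ins_0_fst_cases)
  then have "a = I" "\<Gamma> = ins k {#} G" "\<Delta> = D" using 2 by (auto simp: ins_Suc_ins_0)
  then show ?case using 1 2 q by (intro exI[of _ "(G, D)"]) auto
next
  case (App t u)
  let ?f = "apfst (ins k {#}) :: 'a ctx \<Rightarrow> _"
  have f: "?f 0 = 0" "\<And>r s. ?f (r + s) = ?f r + ?f s"
    by (auto simp: zero_prod_def ins_zero_add)
  from App obtain r1 r2 V J where 1: "r = r1 + r2" "rtyp_t (shift_var_t k t) r1 V"
    "gather arrow_elim (J, U) V" "gather (rtyp_t (shift_var_t k u)) r2 J" by auto
  obtain q1 where q1: "r1 = ?f q1" "rtyp_t t q1 V" using App.IH(1) 1 by blast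
  obtain q2 where q2: "r2 = ?f q2" "gather (rtyp_t u) q2 J"
    using gather_unmap[of _ _ _ ?f "rtyp_t u", OF 1(4) f App.IH(2)] by blast
  have "r = ?f (q1 + q2)" using 1 q1 q2 f by simp
  moreover have "rtyp_t (App t u) (q1 + q2) U" using q1 q2 1 unfolding rtyp_t.simps by blast
  ultimately show ?case by blast
next
  case (Mu c)
  then obtain \<Gamma> \<Delta> V where 1: "r = (\<Gamma>, \<Delta>)" "uchoice V U"
    "rtyp_c (shift_var_c k c) (\<Gamma>, ins 0 V \<Delta>)" by auto
  from Mu.IH[OF 1(3)] obtain q where "(\<Gamma>, ins 0 V \<Delta>) = apfst (ins k {#}) q" "rtyp_c c q" by blast
  then show ?case using 1 by (cases q) auto
next
  case (Named \<gamma> t)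
  then obtain r' U where 1: "r = r' + (0, sing \<gamma> U)" "rtyp_t (shift_var_t k t) r' U" by auto
  then obtain q where q: "r' = apfst (ins k {#}) q" "rtyp_t t q U" using Named.IH by blast
  then have "r = apfst (ins k {#}) (q + (0, sing \<gamma> U))"
    using 1 by (cases q) (simp add: ins_zero_add)
  then show ?case using q unfolding rtyp_c.simps by blast
qed

lemma rtyp_unshift_name:
  "rtyp_t (shift_name_t k t) r U \<Longrightarrow> \<exists>r'. r = apsnd (ins k {#}) r' \<and> rtyp_t t r' U"
  "rtyp_c (shift_name_c k c) r \<Longrightarrow> \<exists>r'. r = apsnd (ins k {#}) r' \<and> rtyp_c c r'"
proof (induction t and c arbitrary: k r U and k r)
  case (Var x)
  then show ?case by (intro exI[of _ "(sing x {#U#}, 0)"]) auto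
next
  case (Lam t)
  then obtain \<Gamma> \<Delta> I V where 1: "r = (\<Gamma>, \<Delta>)" "U = {#Arr I V#}"
    "rtyp_t (shift_name_t k t) (ins 0 I \<Gamma>, \<Delta>) V" by auto
  from Lam.IH[OF 1(3)] obtain q where "(ins 0 I \<Gamma>, \<Delta>) = apsnd (ins k {#}) q" "rtyp_t t q V"
    by blast
  then show ?case using 1 by (cases q) auto
next
  case (App t u)
  let ?f = "apsnd (ins k {#}) :: 'a ctx \<Rightarrow> _"
  have f: "?f 0 = 0" "\<And>r s. ?f (r + s) = ?f r + ?f s"
    by (auto simp: zero_prod_def ins_zero_add)
  from App obtain r1 r2 V J where 1: "r = r1 + r2" "rtyp_t (shift_name_t k t) r1 V"
    "gather arrow_elim (J, U) V" "gather (rtyp_t (shift_name_t k u)) r2 J" by auto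
  obtain q1 where q1: "r1 = ?f q1" "rtyp_t t q1 V" using App.IH(1) 1 by blast
  obtain q2 where q2: "r2 = ?f q2" "gather (rtyp_t u) q2 J"
    using gather_unmap[of _ _ _ ?f "rtyp_t u", OF 1(4) f App.IH(2)] by blast
  have "r = ?f (q1 + q2)" using 1 q1 q2 f by simp
  moreover have "rtyp_t (App t u) (q1 + q2) U" using q1 q2 1 unfolding rtyp_t.simps by blast
  ultimately show ?case by blast
next
  case (Mu c)
  then obtain \<Gamma> \<Delta> V where 1: "r = (\<Gamma>, \<Delta>)" "uchoice V U"
    "rtyp_c (shift_name_c (Suc k) c) (\<Gamma>, ins 0 V \<Delta>)" by auto
  from Mu.IH[OF 1(3)] obtain q where 2: "(\<Gamma>, ins 0 V \<Delta>) = apsnd (ins (Suc k) {#}) q" "rtyp_c c q"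
    by blast
  obtain G a D where q: "q = (G, ins 0 a D)" by (rule ins_0_snd_cases)
  then have "a = V" "\<Delta> = ins k {#} D" "\<Gamma> = G" using 2 by (auto simp: ins_Suc_ins_0)
  then show ?case using 1 2 q by (intro exI[of _ "(G, D)"]) auto
next
  case (Named \<gamma> t)
  let ?\<gamma> = "if \<gamma> < k then \<gamma> else Suc \<gamma>"
  from Named obtain r' U where 1: "r = r' + (0, sing ?\<gamma> U)" "rtyp_t (shift_name_t k t) r' U"
    unfolding shift_name_c.simps rtyp_c.simps by blast
  then obtain q where q: "r' = apsnd (ins k {#}) q" "rtyp_t t q U" using Named.IH by blast
  then have "r = apsnd (ins k {#}) (q + (0, sing \<gamma> U))"
    using 1 by (cases q) (simp add: ins_zero_add ins_sing)
  then show ?case using q unfolding rtyp_c.simps by blast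
qed

text \<open>Anti-substitution: each copy of \<open>u\<close> is cut out and the type it has there
  becomes a type of \<open>x\<close>. Without occurrences of \<open>x\<close>, both its entry and
  \<open>s\<close> are empty.\<close>

lemma rtyp_subst_inv:
  "rtyp_t (subst_t x u t) r' U \<Longrightarrow>
    \<exists>r s. r' = apfst (del x) r + s \<and> gather (rtyp_t u) s (fst r x) \<and> rtyp_t t r U"
  "rtyp_c (subst_c x u c) r' \<Longrightarrow>
    \<exists>r s. r' = apfst (del x) r + s \<and> gather (rtyp_t u) s (fst r x) \<and> rtyp_c c r"
proof (induction t and c arbitrary: x u r' U and x u r')
  case (Var i)
  have U: "U \<noteq> {#}" using Var rtyp_nonempty by blast
  show ?case
  proof (cases "i = x")
    case True
    have "sing x {#U#} x = {#U#}" by (simp add: sing_def)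
    then show ?thesis using True Var U
      \<comment> \<open>The whole typing belongs to \<open>u\<close>, so all of \<open>r'\<close>
        becomes the supply.\<close>
      by (intro exI[of _ "(sing x {#U#}, 0)"] exI[of _ r'])
        (simp add: del_sing_same flip: zero_prod_def)
  next
    case False
    then have "sing i {#U#} x = {#}" by (simp add: sing_def)
    then show ?thesis using False Var
      by (intro exI[of _ "(sing i {#U#}, 0)"] exI[of _ 0]) (auto simp: del_sing split: if_splits)
  qed
next
  case (Lam t)
  then obtain \<Gamma> \<Delta> I V where 1: "r' = (\<Gamma>, \<Delta>)" "U = {#Arr I V#}"
    "rtyp_t (subst_t (Suc x) (shift_var_t 0 u) t) (ins 0 I \<Gamma>, \<Delta>) V" by auto
  let ?f = "apfst (ins 0 {#}) :: 'a ctx \<Rightarrow> _"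
  have f: "?f 0 = 0" "\<And>r s. ?f (r + s) = ?f r + ?f s"
    by (auto simp: zero_prod_def ins_zero_add)
  from Lam.IH[OF 1(3)] obtain q s where 2: "(ins 0 I \<Gamma>, \<Delta>) = apfst (del (Suc x)) q + s"
    "gather (rtyp_t (shift_var_t 0 u)) s (fst q (Suc x))" "rtyp_t t q V" by blast
  obtain s' where s': "s = ?f s'" "gather (rtyp_t u) s' (fst q (Suc x))"
    using gather_unmap[of _ _ _ ?f "rtyp_t u", OF 2(2) f rtyp_unshift_var(1)] by blast
  obtain a G D where q: "q = (ins 0 a G, D)" by (rule ins_0_fst_cases)
  obtain G' D' where G': "s' = (G', D')" by (metis surj_pair)
  have "I = a" "\<Gamma> = del x G + G'" "\<Delta> = D + D'"
    using 2(1) s' q G' by (auto simp: del_Suc_ins_0 ins_add[symmetric])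
  then show ?case using 1 2 s' q G' by (intro exI[of _ "(G, D)"] exI[of _ s']) auto
next
  case (App t v)
  let ?f = "apfst (del x) :: 'a ctx \<Rightarrow> _"
  let ?g = "\<lambda>r :: 'a ctx. fst r x"
  have f: "?f 0 = 0" "\<And>r s. ?f (r + s) = ?f r + ?f s"
    by (auto simp: zero_prod_def del_add)
  have g: "?g 0 = {#}" "\<And>r s. ?g (r + s) = ?g r + ?g s"
    by (auto simp: plus_fun_apply zero_fun_apply)
  from App obtain r1 r2 V J where 1: "r' = r1 + r2" "rtyp_t (subst_t x u t) r1 V"
    "gather arrow_elim (J, U) V" "gather (rtyp_t (subst_t x u v)) r2 J" by auto
  from App.IH(1)[OF 1(2)] obtain q1 s1 where q1: "r1 = ?f q1 + s1"
    "gather (rtyp_t u) s1 (?g q1)" "rtyp_t t q1 V" by blast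
  obtain q2 s2 where q2: "r2 = ?f q2 + s2" "gather (rtyp_t u) s2 (?g q2)" "gather (rtyp_t v) q2 J"
    using gather_extract[of _ _ _ ?g ?f "rtyp_t u" "rtyp_t v", OF 1(4) g f App.IH(2)] by blast
  have "r' = ?f (q1 + q2) + (s1 + s2)" using 1(1) q1(1) q2(1) f(2) by (simp add: ac_simps)
  moreover have "gather (rtyp_t u) (s1 + s2) (?g (q1 + q2))"
    using gather_union[OF q1(2) q2(2)] g(2) by simp
  moreover have "rtyp_t (App t v) (q1 + q2) U" using q1 q2 1 unfolding rtyp_t.simps by blast
  ultimately show ?case by blast
next
  case (Mu c)
  then obtain \<Gamma> \<Delta> V where 1: "r' = (\<Gamma>, \<Delta>)" "uchoice V U"
    "rtyp_c (subst_c x (shift_name_t 0 u) c) (\<Gamma>, ins 0 V \<Delta>)" by auto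
  let ?f = "apsnd (ins 0 {#}) :: 'a ctx \<Rightarrow> _"
  have f: "?f 0 = 0" "\<And>r s. ?f (r + s) = ?f r + ?f s"
    by (auto simp: zero_prod_def ins_zero_add)
  from Mu.IH[OF 1(3)] obtain q s where 2: "(\<Gamma>, ins 0 V \<Delta>) = apfst (del x) q + s"
    "gather (rtyp_t (shift_name_t 0 u)) s (fst q x)" "rtyp_c c q" by blast
  obtain s' where s': "s = ?f s'" "gather (rtyp_t u) s' (fst q x)"
    using gather_unmap[of _ _ _ ?f "rtyp_t u", OF 2(2) f rtyp_unshift_name(1)] by blast
  obtain G a D where q: "q = (G, ins 0 a D)" by (rule ins_0_snd_cases)
  obtain G' D' where G': "s' = (G', D')" by (metis surj_pair)
  have "V = a" "\<Gamma> = del x G + G'" "\<Delta> = D + D'"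
    using 2(1) s' q G' by (auto simp: ins_add[symmetric])
  then show ?case using 1 2 s' q G' by (intro exI[of _ "(G, D)"] exI[of _ s']) auto
next
  case (Named \<gamma> t)
  then obtain q U where 1: "r' = q + (0, sing \<gamma> U)" "rtyp_t (subst_t x u t) q U" by auto
  from Named.IH[OF 1(2)] obtain p s where 2: "q = apfst (del x) p + s"
    "gather (rtyp_t u) s (fst p x)" "rtyp_t t p U" by blast
  let ?p = "p + (0, sing \<gamma> U)"
  have "r' = apfst (del x) ?p + s" using 1 2 by (cases p, cases s) (simp add: del_add ac_simps)
  moreover have "fst ?p x = fst p x" by simp
  moreover have "rtyp_c (Named \<gamma> t) ?p" using 2 unfolding rtyp_c.simps by blast
  ultimately show ?case using 2 by metis
qed

text \<open>Anti-replacement: each argument inserted at a naming by \<alpha> is cut out, and the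
  codomains recorded there give way to the arrows that were eliminated.\<close>

lemma rtyp_repl_inv:
  "rtyp_t (repl_t \<alpha> u t) r' U \<Longrightarrow>
    \<exists>r s. r' = apsnd (erase \<alpha>) r + s \<and>
      gather (arg_elim (\<lambda>W. (0, sing \<alpha> W)) (rtyp_t u)) s (snd r \<alpha>) \<and> rtyp_t t r U"
  "rtyp_c (repl_c \<alpha> u c) r' \<Longrightarrow>
    \<exists>r s. r' = apsnd (erase \<alpha>) r + s \<and>
      gather (arg_elim (\<lambda>W. (0, sing \<alpha> W)) (rtyp_t u)) s (snd r \<alpha>) \<and> rtyp_c c r"
proof (induction t and c arbitrary: \<alpha> u r' U and \<alpha> u r')
  case (Var i)
  then show ?case by (intro exI[of _ r'] exI[of _ 0]) (auto simp: zero_fun_apply)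
next
  case (Lam t)
  then obtain \<Gamma> \<Delta> I V where 1: "r' = (\<Gamma>, \<Delta>)" "U = {#Arr I V#}"
    "rtyp_t (repl_t \<alpha> (shift_var_t 0 u) t) (ins 0 I \<Gamma>, \<Delta>) V" by auto
  let ?f = "apfst (ins 0 {#}) :: 'a ctx \<Rightarrow> _"
  let ?h = "\<lambda>W. (0, sing \<alpha> W) :: 'a ctx"
  have f: "?f 0 = 0" "\<And>r s. ?f (r + s) = ?f r + ?f s" "\<And>W. ?f (?h W) = ?h W"
    by (auto simp: zero_prod_def ins_zero_add)
  from Lam.IH[OF 1(3)] obtain q s where 2: "(ins 0 I \<Gamma>, \<Delta>) = apsnd (erase \<alpha>) q + s"
    "gather (arg_elim ?h (rtyp_t (shift_var_t 0 u))) s (snd q \<alpha>)" "rtyp_t t q V" by blast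
  obtain s' where s': "s = ?f s'" "gather (arg_elim ?h (rtyp_t u)) s' (snd q \<alpha>)"
    using gather_arg_elim_unmap[of ?h _ _ _ ?f ?h "rtyp_t u", OF 2(2) f rtyp_unshift_var(1)] by blast
  obtain a G D where q: "q = (ins 0 a G, D)" by (rule ins_0_fst_cases)
  obtain G' D' where G': "s' = (G', D')" by (metis surj_pair)
  have "I = a" "\<Gamma> = G + G'" "\<Delta> = erase \<alpha> D + D'"
    using 2(1) s' q G' by (auto simp: ins_add[symmetric])
  then show ?case using 1 2 s' q G' by (intro exI[of _ "(G, D)"] exI[of _ s']) auto
next
  case (App t v)
  let ?f = "apsnd (erase \<alpha>) :: 'a ctx \<Rightarrow> _"
  let ?g = "\<lambda>r :: 'a ctx. snd r \<alpha>"
  let ?A = "arg_elim (\<lambda>W. (0, sing \<alpha> W)) (rtyp_t u)"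
  have f: "?f 0 = 0" "\<And>r s. ?f (r + s) = ?f r + ?f s"
    by (auto simp: zero_prod_def erase_add)
  have g: "?g 0 = {#}" "\<And>r s. ?g (r + s) = ?g r + ?g s"
    by (auto simp: plus_fun_apply zero_fun_apply)
  from App obtain r1 r2 V J where 1: "r' = r1 + r2" "rtyp_t (repl_t \<alpha> u t) r1 V"
    "gather arrow_elim (J, U) V" "gather (rtyp_t (repl_t \<alpha> u v)) r2 J" by auto
  from App.IH(1)[OF 1(2)] obtain q1 s1 where q1: "r1 = ?f q1 + s1"
    "gather ?A s1 (?g q1)" "rtyp_t t q1 V" by blast
  obtain q2 s2 where q2: "r2 = ?f q2 + s2" "gather ?A s2 (?g q2)" "gather (rtyp_t v) q2 J"
    using gather_extract[of _ _ _ ?g ?f ?A "rtyp_t v", OF 1(4) g f App.IH(2)] by blast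
  have "r' = ?f (q1 + q2) + (s1 + s2)" using 1(1) q1(1) q2(1) f(2) by (simp add: ac_simps)
  moreover have "gather ?A (s1 + s2) (?g (q1 + q2))"
    using gather_union[OF q1(2) q2(2)] g(2) by simp
  moreover have "rtyp_t (App t v) (q1 + q2) U" using q1 q2 1 unfolding rtyp_t.simps by blast
  ultimately show ?case by blast
next
  case (Mu c)
  then obtain \<Gamma> \<Delta> V where 1: "r' = (\<Gamma>, \<Delta>)" "uchoice V U"
    "rtyp_c (repl_c (Suc \<alpha>) (shift_name_t 0 u) c) (\<Gamma>, ins 0 V \<Delta>)" by auto
  let ?f = "apsnd (ins 0 {#}) :: 'a ctx \<Rightarrow> _"
  let ?h = "\<lambda>W. (0, sing \<alpha> W) :: 'a ctx" and ?h' = "\<lambda>W. (0, sing (Suc \<alpha>) W) :: 'a ctx"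
  have f: "?f 0 = 0" "\<And>r s. ?f (r + s) = ?f r + ?f s" "\<And>W. ?f (?h W) = ?h' W"
    by (auto simp: zero_prod_def ins_zero_add ins_sing)
  from Mu.IH[OF 1(3)] obtain q s where 2: "(\<Gamma>, ins 0 V \<Delta>) = apsnd (erase (Suc \<alpha>)) q + s"
    "gather (arg_elim ?h' (rtyp_t (shift_name_t 0 u))) s (snd q (Suc \<alpha>))" "rtyp_c c q" by blast
  obtain s' where s': "s = ?f s'" "gather (arg_elim ?h (rtyp_t u)) s' (snd q (Suc \<alpha>))"
    using gather_arg_elim_unmap[of ?h' _ _ _ ?f ?h "rtyp_t u", OF 2(2) f rtyp_unshift_name(1)] by blast
  obtain G a D where q: "q = (G, ins 0 a D)" by (rule ins_0_snd_cases)
  obtain G' D' where G': "s' = (G', D')" by (metis surj_pair)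
  have "V = a" "\<Gamma> = G + G'" "\<Delta> = erase \<alpha> D + D'"
    using 2(1) s' q G' by (auto simp: ins_add[symmetric])
  then show ?case using 1 2 s' q G' by (intro exI[of _ "(G, D)"] exI[of _ s']) auto
next
  case (Named \<gamma> t)
  let ?f = "apsnd (erase \<alpha>) :: 'a ctx \<Rightarrow> _"
  let ?h = "\<lambda>W. (0, sing \<alpha> W) :: 'a ctx"
  show ?case
  proof (cases "\<gamma> = \<alpha>")
    case False
    with Named.prems obtain q U where 1: "r' = q + (0, sing \<gamma> U)" "rtyp_t (repl_t \<alpha> u t) q U"
      by auto
    from Named.IH[OF 1(2)] obtain p s where 2: "q = ?f p + s"
      "gather (arg_elim ?h (rtyp_t u)) s (snd p \<alpha>)" "rtyp_t t p U" by blast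
    let ?p = "p + (0, sing \<gamma> U)"
    have "r' = ?f ?p + s"
      using 1 2 False by (cases p, cases s) (simp add: erase_add erase_sing ac_simps)
    moreover have "snd ?p \<alpha> = snd p \<alpha>" using False by (simp add: sing_def plus_fun_apply)
    moreover have "rtyp_c (Named \<gamma> t) ?p" using 2 unfolding rtyp_c.simps by blast
    ultimately show ?thesis using 2 by metis
  next
    case True
    with Named.prems obtain q W where "r' = q + (0, sing \<alpha> W)"
      "rtyp_t (App (repl_t \<alpha> u t) u) q W"
      by (auto simp del: rtyp_t.simps)
    then obtain q1 q2 V J where 1: "r' = q1 + q2 + (0, sing \<alpha> W)" "rtyp_t (repl_t \<alpha> u t) q1 V"
      "gather arrow_elim (J, W) V" "gather (rtyp_t u) q2 J"
      unfolding rtyp_t.simps by blast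
    from Named.IH[OF 1(2)] obtain p s where 2: "q1 = ?f p + s"
      "gather (arg_elim ?h (rtyp_t u)) s (snd p \<alpha>)" "rtyp_t t p V" by blast
    \<comment> \<open>After expansion \<open>t\<close> is named directly, so \<alpha> receives its
      arrows \<open>V\<close> in place of \<open>W\<close>.\<close>
    let ?p = "p + (0, sing \<alpha> V)"
    have "?h {#} = 0" "\<And>U V. ?h (U + V) = ?h U + ?h V"
      by (auto simp: sing_def pointwise zero_prod_def)
    then have "gather (arg_elim ?h (rtyp_t u)) (?h W + q2) V"
      using gather_arg_elim[of ?h] 1 by metis
    with 2(2) have "gather (arg_elim ?h (rtyp_t u)) (s + (?h W + q2)) (snd p \<alpha> + V)"
      by (rule gather_union)
    moreover have "snd ?p \<alpha> = snd p \<alpha> + V" by (simp add: sing_def plus_fun_apply)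
    moreover have "r' = ?f ?p + (s + (?h W + q2))"
      using 1 2 by (cases p, cases s) (simp add: erase_add erase_sing ac_simps)
    moreover have "rtyp_c (Named \<gamma> t) ?p" using 2 True unfolding rtyp_c.simps by blast
    ultimately show ?thesis by metis
  qed
qed


section \<open>Strongly normalizing objects are typable\<close>

text \<open>The third argument of \<open>whred\<close> is the argument of the contracted redex, the only subterm that
  a head step can erase.\<close>

inductive whred :: "trm \<Rightarrow> trm \<Rightarrow> trm \<Rightarrow> bool" where
  beta: "whred (App (Lam t) u) (subst_t 0 u t) u"
| mu: "whred (App (Mu c) u) (Mu (repl_c 0 (shift_name_t 0 u) c)) u"
| App: "whred t t' u \<Longrightarrow> whred (App t v) (App t' v) u"

inductive neutral :: "trm \<Rightarrow> bool" where
  "neutral (Var x)"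
| "neutral t \<Longrightarrow> neutral (App t u)"

inductive subobj :: "obj \<Rightarrow> obj \<Rightarrow> bool" where
  Lam: "subobj (Term t) (Term (Lam t))"
| AppL: "subobj (Term t) (Term (App t u))"
| AppR: "subobj (Term u) (Term (App t u))"
| Mu: "subobj (Cmd c) (Term (Mu c))"
| Named: "subobj (Term t) (Cmd (Named \<alpha> t))"

text \<open>For an application the function part decides: an abstraction or mu-abstraction there
  makes a redex, and the other two cases extend along the spine.\<close>

lemma trm_head_cases:
  obtains (Lam) t' where "t = Lam t'" | (Mu) c where "t = Mu c"
  | (neutral) "neutral t" | (whred) t' u where "whred t t' u"
proof (induction t arbitrary: thesis rule: trm.induct[where ?P2.0 = "\<lambda>_. True"])
  case (App t u)
  show ?case
    by (rule App.IH(1)) (use App.prems whred.intros neutral.intros in blast)+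
qed (auto intro: neutral.intros)

lemma whred_red: "whred t t' u \<Longrightarrow> red (Term t) (Term t')"
  by (induction rule: whred.induct) (auto intro: red.intros)

lemma whred_subobj: "whred t t' u \<Longrightarrow> subobj\<^sup>+\<^sup>+ (Term u) (Term t)"
  by (induction rule: whred.induct) (auto intro: subobj.intros tranclp.intros)

text \<open>The independent typing \<open>q\<close> serves when \<open>I\<close> is empty, that is,
  when the expanded step erases its argument.\<close>

lemma ichoice_exists:
  assumes "gather P s I" "P q U" "U \<noteq> {#}"
  obtains J s' where "ichoice I J" "gather P s' J"
  using assms that[of I s] that[of "{#U#}" q] by (cases "I = {#}") (auto simp: ichoice_def)

text \<open>Keeping \<open>W\<close> is what lets the induction climb the spine. The assignments may
  change, as an erased argument brings its own; this is harmless since no binder encloses a head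
  redex.\<close>

lemma whred_expansion:
  assumes "whred t t' u" "rtyp_t t' r (W :: 'b uty)" "rtyp_t u q (U :: 'b uty)"
  shows "\<exists>r'. rtyp_t t r' W"
  using assms
proof (induction arbitrary: r W rule: whred.induct)
  case (beta t u)
  from rtyp_subst_inv(1)[OF beta(1)] obtain p s where 1:
    "gather (rtyp_t u) s (fst p 0)" "rtyp_t t p W" by blast
  obtain I \<Gamma> \<Delta> where p: "p = (ins 0 I \<Gamma>, \<Delta>)" by (rule ins_0_fst_cases)
  have "gather (rtyp_t u) s I" using 1(1) p by simp
  then obtain J s' where "ichoice I J" "gather (rtyp_t u) s' J"
    using ichoice_exists[of "rtyp_t u" s I q U] beta(2) rtyp_nonempty[OF beta(2)] by blast
  moreover have "gather arrow_elim (J, W) {#Arr I W#}"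
    using calculation rtyp_nonempty[OF 1(2)] by simp
  moreover have "rtyp_t (Lam t) (\<Gamma>, \<Delta>) {#Arr I W#}" using 1 p by auto
  ultimately show ?case unfolding rtyp_t.simps(3) by blast
next
  case (mu c u)
  obtain \<Gamma> \<Delta> D where 1: "uchoice D W" "rtyp_c (repl_c 0 (shift_name_t 0 u) c) (\<Gamma>, ins 0 D \<Delta>)"
    using mu(1) by auto
  let ?h = "\<lambda>W. (0, sing 0 W) :: 'b ctx" and ?f = "apsnd (ins 0 {#}) :: 'b ctx \<Rightarrow> _"
  have h: "?h {#} = 0" "\<And>U V. ?h (U + V) = ?h U + ?h V"
    by (auto simp: sing_def pointwise zero_prod_def)
  have f: "?f 0 = 0" "\<And>r s. ?f (r + s) = ?f r + ?f s"
    by (auto simp: zero_prod_def ins_zero_add)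
  from rtyp_repl_inv(2)[OF 1(2)] obtain p s where 2: "(\<Gamma>, ins 0 D \<Delta>) = apsnd (erase 0) p + s"
    "gather (arg_elim ?h (rtyp_t (shift_name_t 0 u))) s (snd p 0)" "rtyp_c c p" by blast
  obtain G V D' where p: "p = (G, ins 0 V D')" by (rule ins_0_snd_cases)
  from 2(2) p have "gather (arg_elim ?h (rtyp_t (shift_name_t 0 u))) s V" by simp
  then obtain J E s1 where 3: "s = ?h E + s1" "gather arrow_elim (J, E) V"
    "gather (rtyp_t (shift_name_t 0 u)) s1 J"
    using gather_arg_elim[of ?h, OF h] by blast
  obtain s2 where 4: "s1 = ?f s2" "gather (rtyp_t u) s2 J"
    using gather_unmap[of _ _ _ ?f "rtyp_t u", OF 3(3) f rtyp_unshift_name(1)] by blast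
  \<comment> \<open>At entry 0 the erased assignment and the renamed argument contribute nothing, so
    what remains are the recorded codomains \<open>E\<close>.\<close>
  have "ins 0 D \<Delta> 0 = (ins 0 {#} D' + (sing 0 E + ins 0 {#} (snd s2))) 0"
    using 2(1) p 3 4 by (cases s2) simp
  then have "D = E" by (simp add: plus_fun_apply sing_def)
  show ?case
  proof (cases "V = {#}")
    case True
    then have "D = {#}" using 3(2) \<open>D = E\<close> by (simp add: zero_prod_def)
    then obtain \<xi> where W: "blind \<xi>" "W = {#\<xi>#}" using 1(1) by (auto simp: uchoice_def)
    \<comment> \<open>Name 0 has no type, so \<open>W\<close> is a chosen blind type and an arrow
      from the empty intersection to it is blind too. Its application demands a typing of the erased
      argument, which \<open>q\<close> supplies.\<close>
    then have "uchoice V {#Arr {#} W#}" using True by (auto simp: uchoice_def intro: blind.intros)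
    then have "rtyp_t (Mu c) (G, D') {#Arr {#} W#}" using 2(3) p by auto
    moreover have "ichoice {#} {#U#}" using rtyp_nonempty[OF mu(2)] by (simp add: ichoice_def)
    then have "gather arrow_elim ({#U#}, W) {#Arr {#} W#}" using W by simp
    moreover have "gather (rtyp_t u) q {#U#}" using mu(2) by simp
    ultimately show ?thesis unfolding rtyp_t.simps(3) by blast
  next
    case False
    then have "D \<noteq> {#}" using gather_arrow_elim_nonempty[OF 3(2)] \<open>D = E\<close> by simp
    then have "W = E" using 1(1) \<open>D = E\<close> by (simp add: uchoice_def)
    moreover have "rtyp_t (Mu c) (G, D') V" using 2(3) p False by (auto simp: uchoice_def)
    ultimately show ?thesis using 3(2) 4(2) unfolding rtyp_t.simps(3) by blast
  qed
next
  case (App t t' u v)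
  obtain r1 r2 V J where "rtyp_t t' r1 V" "gather arrow_elim (J, W) V" "gather (rtyp_t v) r2 J"
    using App.prems(1) by auto
  moreover from this App obtain r1' where "rtyp_t t r1' V" by blast
  ultimately show ?case unfolding rtyp_t.simps by blast
qed

text \<open>The head variable accepts any type, so an arrow fitting the known typing of each
  argument can be demanded of it; leaving \<open>V\<close> free makes the induction work.\<close>

lemma neutral_typable:
  assumes "neutral t" "\<And>u. subobj\<^sup>+\<^sup>+ (Term u) (Term t) \<Longrightarrow> \<exists>r U. rtyp_t u r (U :: 'b uty)"
    "V \<noteq> {#}"
  shows "\<exists>r. rtyp_t t r (V :: 'b uty)"
  using assms
proof (induction arbitrary: V)
  case (1 x)
  then show ?case by auto
next
  case (2 t u)
  obtain q U where U: "rtyp_t u q (U :: 'b uty)"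
    using 2(3) subobj.AppR by blast
  have "subobj\<^sup>+\<^sup>+ (Term v) (Term (App t u))" if "subobj\<^sup>+\<^sup>+ (Term v) (Term t)" for v
    using that subobj.AppL by (rule tranclp.trancl_into_trancl)
  then have "\<exists>r. rtyp_t t r {#Arr {#U#} V#}" using 2 by simp
  moreover have "gather arrow_elim ({#U#}, V) {#Arr {#U#} V#}"
    using 2(4) by (simp add: ichoice_def)
  moreover have "gather (rtyp_t u) q {#U#}" using U by simp
  ultimately show ?case unfolding rtyp_t.simps(3) by blast
qed

section \<open>Well-foundedness of reduction joined with the subterm relation\<close>

lemma red_Term: "red (Term t) ob \<Longrightarrow> \<exists>t'. ob = Term t'"
  by (erule red.cases) auto

lemma red_Cmd: "red (Cmd c) ob \<Longrightarrow> \<exists>c'. ob = Cmd c'"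
  by (erule red.cases) auto

text \<open>Reduction is closed under contexts, so a step in a subobject is a step of the whole that
  keeps the reduct as a subobject.\<close>

lemma subobj_red:
  assumes "subobj\<^sup>*\<^sup>* s ob" "red s s'"
  shows "\<exists>ob'. red ob ob' \<and> subobj\<^sup>*\<^sup>* s' ob'"
  using assms
proof (induction rule: rtranclp_induct)
  case (step o1 o2)
  then obtain o1' where o1': "red o1 o1'" "subobj\<^sup>*\<^sup>* s' o1'" by blast
  from step(2) o1'(1) have "\<exists>o2'. red o2 o2' \<and> subobj o1' o2'"
  proof cases
    case (Lam t)
    then show ?thesis using o1'(1) red_Term red.Lam subobj.Lam by metis
  next
    case (AppL t u)
    then show ?thesis using o1'(1) red_Term red.AppL subobj.AppL by metis
  next
    case (AppR u t)
    then show ?thesis using o1'(1) red_Term red.AppR subobj.AppR by metis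
  next
    case (Mu c)
    then show ?thesis using o1'(1) red_Cmd red.Mu subobj.Mu by metis
  next
    case (Named t \<alpha>)
    then show ?thesis using o1'(1) red_Term red.Named subobj.Named by metis
  qed
  then show ?case using o1'(2) by (meson rtranclp.rtrancl_into_rtrancl)
qed auto

definition progress :: "obj \<Rightarrow> obj \<Rightarrow> bool" where
  "progress s ob \<longleftrightarrow> red ob s \<or> subobj\<^sup>+\<^sup>+ s ob"

lemma wfp_subobj: "wfP subobj\<^sup>+\<^sup>+"
proof -
  let ?size = "case_obj size size"
  have "subobj s ob \<Longrightarrow> ?size s < ?size ob" for s ob
    by (induction rule: subobj.induct) auto
  then have "wfP subobj" by (rule wfp_if_convertible_to_nat)
  then show ?thesis by (simp add: wfp_tranclp)
qed

text \<open>Nested induction: reductions of the enclosing \<open>ob\<close> outside, proper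
  subobjects of \<open>s\<close> inside. By \<open>subobj_red\<close>, a step of \<open>s\<close>
  moves \<open>ob\<close> to one of its reducts.\<close>

lemma accp_progress:
  assumes "Wellfounded.accp (\<lambda>s ob. red ob s) ob" "subobj\<^sup>*\<^sup>* s ob"
  shows "Wellfounded.accp progress s"
  using assms
proof (induction arbitrary: s rule: accp.induct)
  case (accI ob)
  from accI.prems show ?case
  proof (induction s rule: wfp_induct_rule[OF wfp_subobj])
    case (1 s)
    show ?case
    proof (rule accp.accI)
      fix s' assume "progress s' s"
      then consider "red s s'" | "subobj\<^sup>+\<^sup>+ s' s" by (auto simp: progress_def)
      then show "Wellfounded.accp progress s'"
      proof cases
        case 1
        then show ?thesis using subobj_red \<open>subobj\<^sup>*\<^sup>* s ob\<close> accI.IH by blast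
      next
        case 2
        moreover from this have "subobj\<^sup>*\<^sup>* s' ob"
          using 1(2) by (meson rtranclp_trans tranclp_into_rtranclp)
        ultimately show ?thesis using 1(1) by blast
      qed
    qed
  qed
qed

lemma strongly_normalizing_accp:
  assumes "strongly_normalizing ob"
  shows "Wellfounded.accp (\<lambda>s ob. red ob s) ob"
proof (rule ccontr)
  let ?A = "Wellfounded.accp (\<lambda>s ob. red ob s)"
  assume "\<not> ?A ob"
  moreover have "\<exists>y. \<not> ?A y \<and> red x y" if "\<not> ?A x" for x
    using that accp.accI[of "\<lambda>s ob. red ob s" x] by blast
  \<comment> \<open>An inaccessible object has an inaccessible reduct, so dependent choice yields an
    infinite reduction.\<close>
  ultimately obtain f where "f 0 = ob" "\<And>i. \<not> ?A (f i) \<and> red (f i) (f (Suc i))"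
    using dependent_nat_choice[of "\<lambda>n x. \<not> ?A x \<and> (n = 0 \<longrightarrow> x = ob)" "\<lambda>_. red"] by auto
  then show False using assms unfolding strongly_normalizing_def by blast
qed

section \<open>Building typings by well-founded induction\<close>

fun rtypable :: "'b itself \<Rightarrow> obj \<Rightarrow> bool" where
  "rtypable _ (Term t) \<longleftrightarrow> (\<exists>r U. rtyp_t t r (U :: 'b uty))"
| "rtypable _ (Cmd c) \<longleftrightarrow> (\<exists>r :: 'b ctx. rtyp_c c r)"

lemma accp_rtypable:
  assumes "Wellfounded.accp progress ob"
  shows "rtypable TYPE('b) ob"
  using assms
proof (induction rule: accp.induct)
  case (accI ob)
  have sub: "rtypable TYPE('b) s" if "subobj s ob" for s
    using accI.IH[of s] that by (auto simp: progress_def)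
  show ?case
  proof (cases ob)
    case (Term t)
    show ?thesis
    proof (cases t rule: trm_head_cases)
      case (Lam t')
      then obtain r U where "rtyp_t t' r (U :: 'b uty)" using sub Term subobj.Lam by fastforce
      moreover obtain I \<Gamma> \<Delta> where "r = (ins 0 I \<Gamma>, \<Delta>)" by (rule ins_0_fst_cases)
      ultimately have "rtyp_t t (\<Gamma>, \<Delta>) {#Arr I U#}" using Lam by auto
      then show ?thesis unfolding Term rtypable.simps by blast
    next
      case (Mu c)
      then obtain r :: "'b ctx" where "rtyp_c c r" using sub Term subobj.Mu by fastforce
      moreover obtain \<Gamma> U \<Delta> where "r = (\<Gamma>, ins 0 U \<Delta>)" by (rule ins_0_snd_cases)
      \<comment> \<open>Some base type always exists and is blind, so the choice never gets
        stuck.\<close>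
      moreover have "\<exists>V. uchoice U V"
        by (cases "U = {#}") (auto simp: uchoice_def intro: blind.intros(1))
      ultimately have "\<exists>V. rtyp_t t (\<Gamma>, \<Delta>) V" using Mu by auto
      then show ?thesis unfolding Term rtypable.simps by blast
    next
      case neutral
      \<comment> \<open>Any non-empty union type would do.\<close>
      have "\<exists>r. rtyp_t t r ({#undefined#} :: 'b uty)"
      proof (rule neutral_typable[OF neutral])
        fix u assume "subobj\<^sup>+\<^sup>+ (Term u) (Term t)"
        then show "\<exists>r U. rtyp_t u r (U :: 'b uty)"
          using accI.IH[of "Term u"] Term by (auto simp: progress_def)
      qed simp
      then show ?thesis unfolding Term rtypable.simps by blast
    next
      case (whred t' u)
      \<comment> \<open>Both the head reduct and the argument of the redex lie below
        \<open>t\<close>: one by reduction, the other as a subterm.\<close>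
      then obtain r W q U where "rtyp_t t' r (W :: 'b uty)" "rtyp_t u q (U :: 'b uty)"
        using accI.IH[of "Term t'"] accI.IH[of "Term u"] whred_red whred_subobj Term
        by (auto simp: progress_def)
      from whred_expansion[OF whred this] show ?thesis
        unfolding Term rtypable.simps by blast
    qed
  next
    case (Cmd c)
    then obtain \<alpha> t where c: "c = Named \<alpha> t" by (cases c)
    then obtain r U where "rtyp_t t r (U :: 'b uty)" using sub Cmd subobj.Named by fastforce
    then have "rtyp_c c (r + (0, sing \<alpha> U))" unfolding c rtyp_c.simps by blast
    then show ?thesis unfolding Cmd rtypable.simps by blast
  qed
qed

lemma rtypable_typable: "rtypable TYPE('b) ob \<Longrightarrow> typable TYPE('b) ob"
  using rtyp_derives by (cases ob) (fastforce simp: typable_def)+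

theorem theorem6p4:
  fixes ob :: obj
  shows "(typable TYPE('b) ob \<longleftrightarrow> strongly_normalizing ob) \<and>
    (\<forall>(\<Pi> :: 'b deriv) \<Gamma> A \<Delta>. derives \<Pi> \<Gamma> ob A \<Delta> \<longrightarrow>
       (\<forall>n ob'. (red ^^ n) ob ob' \<longrightarrow> n \<le> sz \<Pi>))"
proof (intro conjI iffI allI impI)
  assume "typable TYPE('b) ob"
  then show "strongly_normalizing ob"
    using derives_wtyp(1) wtyp_strongly_normalizing unfolding typable_def by blast
next
  assume "strongly_normalizing ob"
  then have "Wellfounded.accp progress ob"
    using strongly_normalizing_accp accp_progress by blast
  then show "typable TYPE('b) ob" by (intro rtypable_typable accp_rtypable)
next
  fix \<Pi> :: "'b deriv" and \<Gamma> A \<Delta> n ob'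
  assume "derives \<Pi> \<Gamma> ob A \<Delta>" "(red ^^ n) ob ob'"
  then show "n \<le> sz \<Pi>" using derives_wtyp(1) wtyp_bounds_reduction by blast
qed

end
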